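(* Let $G$ be a discrete, countable group. Then a subset $X\subseteq G$ is right Asplund (i.e. its characteristic function $1_{X}\in L^{\infty}(G)=\ell^{\infty}(G)$ is a right Asplund functional on $L^{1}(G)=\ell^{1}(G)$) if and only if $\mathfrak{G}\circledast 1_{X}=\{\omega\circledast 1_{X}:\omega\in\mathfrak{G}\}$ is countable.
   Context: All vector spaces are over $\mathbb{R}$; $B_{V}$ is the closed unit ball of a Banach space $V$. $\mathcal{A}:=L^{1}(G)=\ell^{1}(G)$ (Haar measure = counting measure) is the Banach algebra with convolution $(a\star b)(g)=\sum_{h\in G}a(h)b(h^{-1}g)$, and $\mathcal{A}^{*}$ is identified with $L^{\infty}(G)=\ell^{\infty}(G)$ via $\langle\varphi,a\rangle=\sum_{g}a(g)\varphi(g)$. The bidual $\mathcal{A}^{**}=\ell^{\infty}(G)^{*}$ is identified (Yosida–Hewitt) with the bounded real-valued finitely additive measures on all subsets of $G$, acting by integration. $\mathfrak{G}\subseteq\mathcal{A}^{**}$ is the set of such finitely additive measures $\omega$ with $\omega(G)=1$ and $\omega(A)\in\{0,1\}$ for all $A\subseteq G$. Actions: for $a,b\in\mathcal{A}$, $\varphi\in\mathcal{A}^{*}$, $\mu\in\mathcal{A}^{**}$: $\langle\varphi\circledast a,b\rangle:=\langle\varphi,a\star b\rangle$ and $\langle\mu\circledast\varphi,b\rangle:=\langle\mu,\varphi\circledast b\rangle$. $\varphi\in\mathcal{A}^{*}$ is right Asplund if $\varphi\circledast B_{\mathcal{A}}=\{\varphi\circledast a:a\in B_{\mathcal{A}}\}$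 is an Asplund subset of $\mathcal{A}^{*}$. A bounded subset $C$ of a Banach space $V$ is Asplund if it is a fragmented family of functions on $(B_{V^{*}},w^{*})$, meaning: for every nonempty $A\subseteq B_{V^{*}}$ and $\varepsilon>0$ there is a weak-star open $O$ with $O\cap A\ne\emptyset$ and $\mathrm{diam}\,\{\langle \psi,x\rangle:\psi\in O\cap A\}<\varepsilon$ for every $x\in C$. Equivalently, for every countable $D\subseteq C$ the pseudometric space $(B_{V^{*}},\rho_{D})$ is separable, where $\rho_{D}(\varphi,\psi)=\sup_{x\in D}|\langle\varphi-\psi,x\rangle|$. *)

theory Defs
  imports "HOL-Analysis.Analysis"
begin

section \<open>Module actions on the dual and bidual of a Banach algebra\<close>

lift_definition dual_act ::
    "('a::real_normed_algebra \<Rightarrow>\<^sub>L real) \<Rightarrow> 'a \<Rightarrow> ('a \<Rightarrow>\<^sub>L real)"  (infixl "\<circledast>" 70)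
  is "\<lambda>\<phi> a b. \<phi> (a * b)"
  by (rule bounded_linear_compose[OF _ bounded_linear_mult_right])

lemma norm_dual_act_le: "norm (\<phi> \<circledast> a) \<le> norm \<phi> * norm a"
proof (rule norm_blinfun_bound)
  fix b
  have "norm (blinfun_apply \<phi> (a * b)) \<le> norm \<phi> * norm (a * b)"
    by (rule norm_blinfun)
  also have "\<dots> \<le> norm \<phi> * (norm a * norm b)"
    by (intro mult_left_mono norm_mult_ineq norm_ge_zero)
  finally show "norm (blinfun_apply (\<phi> \<circledast> a) b) \<le> norm \<phi> * norm a * norm b"
    by (simp add: dual_act.rep_eq mult.assoc)
qed auto

lift_definition bidual_act ::
    "(('a::real_normed_algebra \<Rightarrow>\<^sub>L real) \<Rightarrow>\<^sub>L real) \<Rightarrow> ('a \<Rightarrow>\<^sub>L real) \<Rightarrow> ('a \<Rightarrow>\<^sub>L real)"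
    (infixl "\<circledast>\<circledast>" 70)
  is "\<lambda>\<mu> \<phi> b. \<mu> (\<phi> \<circledast> b)"
proof -
  fix \<mu> :: "('a \<Rightarrow>\<^sub>L real) \<Rightarrow> real" and \<phi> :: "'a \<Rightarrow>\<^sub>L real"
  assume \<mu>: "bounded_linear \<mu>"
  have "bounded_linear (\<lambda>b. \<phi> \<circledast> b)"
  proof (rule bounded_linear_intro)
    show "\<phi> \<circledast> (x + y) = \<phi> \<circledast> x + \<phi> \<circledast> y" for x y
      by (rule blinfun_eqI) (simp add: dual_act.rep_eq plus_blinfun.rep_eq distrib_right blinfun.add_right)
    show "\<phi> \<circledast> (r *\<^sub>R x) = r *\<^sub>R (\<phi> \<circledast> x)" for r x
      by (rule blinfun_eqI) (simp add: dual_act.rep_eq scaleR_blinfun.rep_eq blinfun.scaleR_right)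
    show "norm (\<phi> \<circledast> x) \<le> norm x * norm \<phi>" for x
      using norm_dual_act_le[of \<phi> x] by (simp add: mult.commute)
  qed
  then show "bounded_linear (\<lambda>b. \<mu> (\<phi> \<circledast> b))"
    by (rule bounded_linear_compose[OF \<mu>])
qed


section \<open>Asplund sets and right Asplund functionals\<close>

text \<open>For real-valued functionals, the topology of pointwise convergence
  \<^const>\<open>strong_operator_topology\<close> on \<^typ>\<open>'v \<Rightarrow>\<^sub>L real\<close> is the weak-star topology.\<close>

abbreviation weak_star_topology :: "('v::real_normed_vector \<Rightarrow>\<^sub>L real) topology"
  where "weak_star_topology \<equiv> strong_operator_topology"

definition fragmented_family :: "'v::real_normed_vector set \<Rightarrow> bool" where
  "fragmented_family C \<longleftrightarrow>
     (\<forall>A \<epsilon>. A \<noteq> {} \<and> A \<subseteq> cball 0 1 \<and> \<epsilon> > 0 \<longrightarrow>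
        (\<exists>O'. openin weak_star_topology O' \<and> O' \<inter> A \<noteq> {} \<and>
           (\<forall>x\<in>C. diameter ((\<lambda>\<psi>::'v \<Rightarrow>\<^sub>L real. blinfun_apply \<psi> x) ` (O' \<inter> A)) < \<epsilon>)))"

definition asplund_set :: "'v::banach set \<Rightarrow> bool" where
  "asplund_set C \<longleftrightarrow> bounded C \<and> fragmented_family C"

definition right_asplund :: "('a::{real_normed_algebra,banach} \<Rightarrow>\<^sub>L real) \<Rightarrow> bool" where
  "right_asplund \<phi> \<longleftrightarrow> asplund_set ((\<lambda>a. \<phi> \<circledast> a) ` cball 0 1)"


section \<open>The Banach algebra of summable functions on a discrete group\<close>

typedef 'g ell1 = "{a :: 'g \<Rightarrow> real. (\<lambda>g. \<bar>a g\<bar>) summable_on UNIV}"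
  morphisms ell1_apply Abs_ell1
  by (rule exI[of _ "\<lambda>_. 0"]) simp

setup_lifting type_definition_ell1

lemma ell1_eqI: "(\<And>g. ell1_apply a g = ell1_apply b g) \<Longrightarrow> a = b"
  by transfer auto

lemma summable_abs_iff: "(\<lambda>g. \<bar>a g\<bar>) summable_on S \<longleftrightarrow> (a :: _ \<Rightarrow> real) summable_on S"
  using summable_on_iff_abs_summable_on_real[of a S] by simp

lemma summable_diff:
  fixes a b :: "'g \<Rightarrow> real"
  assumes "a summable_on S" and "b summable_on S"
  shows "(\<lambda>g. a g - b g) summable_on S"
  using summable_on_add[OF assms(1) summable_on_cmult_right[OF assms(2), of "-1"]] by simp

instantiation ell1 :: (type) real_normed_vector
begin

lift_definition norm_ell1 :: "'a ell1 \<Rightarrow> real" is "\<lambda>a. \<Sum>\<^sub>\<infinity>g. \<bar>a g\<bar>" .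

lift_definition zero_ell1 :: "'a ell1" is "\<lambda>_. 0" by simp

lift_definition plus_ell1 :: "'a ell1 \<Rightarrow> 'a ell1 \<Rightarrow> 'a ell1" is "\<lambda>a b g. a g + b g"
  by (simp add: summable_abs_iff summable_on_add)

lift_definition uminus_ell1 :: "'a ell1 \<Rightarrow> 'a ell1" is "\<lambda>a g. - a g" by simp

lift_definition minus_ell1 :: "'a ell1 \<Rightarrow> 'a ell1 \<Rightarrow> 'a ell1" is "\<lambda>a b g. a g - b g"
  by (simp add: summable_abs_iff summable_diff)

lift_definition scaleR_ell1 :: "real \<Rightarrow> 'a ell1 \<Rightarrow> 'a ell1" is "\<lambda>r a g. r * a g"
  by (simp add: summable_abs_iff summable_on_cmult_right)

definition dist_ell1 :: "'a ell1 \<Rightarrow> 'a ell1 \<Rightarrow> real"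
  where "dist_ell1 a b = norm (a - b)"

definition uniformity_ell1 :: "('a ell1 \<times> 'a ell1) filter"
  where "uniformity_ell1 = (INF e\<in>{0<..}. principal {(x, y). dist x y < e})"

definition open_ell1 :: "'a ell1 set \<Rightarrow> bool"
  where "open_ell1 S = (\<forall>x\<in>S. \<forall>\<^sub>F (x', y) in uniformity. x' = x \<longrightarrow> y \<in> S)"

definition sgn_ell1 :: "'a ell1 \<Rightarrow> 'a ell1"
  where "sgn_ell1 x = inverse (norm x) *\<^sub>R x"

instance
proof
  fix x y z :: "'a ell1" and r s :: real
  show "x + y + z = x + (y + z)" "x + y = y + x" "0 + x = x" "- x + x = 0" "x - y = x + - y"
    "r *\<^sub>R (x + y) = r *\<^sub>R x + r *\<^sub>R y" "(r + s) *\<^sub>R x = r *\<^sub>R x + s *\<^sub>R x"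
    "r *\<^sub>R s *\<^sub>R x = (r * s) *\<^sub>R x" "1 *\<^sub>R x = x"
    by (transfer; simp add: fun_eq_iff algebra_simps)+
  show "dist x y = norm (x - y)" "sgn x = inverse (norm x) *\<^sub>R x"
    "uniformity = (INF e\<in>{0<..}. principal {(x, y :: 'a ell1). dist x y < e})"
    by (simp_all add: dist_ell1_def sgn_ell1_def uniformity_ell1_def)
  show "open U \<longleftrightarrow> (\<forall>x\<in>U. \<forall>\<^sub>F (x', y) in uniformity. x' = x \<longrightarrow> y \<in> U)" for U :: "'a ell1 set"
    by (rule open_ell1_def)
  show "norm x = 0 \<longleftrightarrow> x = 0"
  proof transfer
    fix x :: "'a \<Rightarrow> real"
    assume x: "(\<lambda>g. \<bar>x g\<bar>) summable_on UNIV"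
    show "(\<Sum>\<^sub>\<infinity>g. \<bar>x g\<bar>) = 0 \<longleftrightarrow> x = (\<lambda>_. 0)"
      using nonneg_infsum_le_0D[of "\<lambda>g. \<bar>x g\<bar>" UNIV] x by fastforce
  qed
  show "norm (x + y) \<le> norm x + norm y"
  proof transfer
    fix x y :: "'a \<Rightarrow> real"
    assume x: "(\<lambda>g. \<bar>x g\<bar>) summable_on UNIV" and y: "(\<lambda>g. \<bar>y g\<bar>) summable_on UNIV"
    have "(\<Sum>\<^sub>\<infinity>g. \<bar>x g + y g\<bar>) \<le> (\<Sum>\<^sub>\<infinity>g. \<bar>x g\<bar> + \<bar>y g\<bar>)"
      using x y by (intro infsum_mono summable_on_add) (auto simp: summable_abs_iff summable_on_add)
    also have "\<dots> = (\<Sum>\<^sub>\<infinity>g. \<bar>x g\<bar>) + (\<Sum>\<^sub>\<infinity>g. \<bar>y g\<bar>)"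
      using x y by (rule infsum_add)
    finally show "(\<Sum>\<^sub>\<infinity>g. \<bar>x g + y g\<bar>) \<le> (\<Sum>\<^sub>\<infinity>g. \<bar>x g\<bar>) + (\<Sum>\<^sub>\<infinity>g. \<bar>y g\<bar>)" .
  qed
  show "norm (r *\<^sub>R x) = \<bar>r\<bar> * norm x"
    by transfer (simp add: abs_mult infsum_cmult_right')
qed

end

lemma abs_ell1_apply_le: "\<bar>ell1_apply a g\<bar> \<le> norm a"
  using finite_sum_le_infsum[of "\<lambda>g. \<bar>ell1_apply a g\<bar>" UNIV "{g}"] ell1_apply[of a]
  by (simp add: norm_ell1.rep_eq)

instance ell1 :: (type) banach
proof
  fix X :: "nat \<Rightarrow> 'a ell1"
  assume X: "Cauchy X"
  have "Cauchy (\<lambda>n. ell1_apply (X n) g)" for g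
  proof (rule metric_CauchyI)
    fix e :: real assume "e > 0"
    then obtain M where M: "\<And>m n. m \<ge> M \<Longrightarrow> n \<ge> M \<Longrightarrow> dist (X m) (X n) < e"
      using X unfolding Cauchy_def by blast
    show "\<exists>M. \<forall>m\<ge>M. \<forall>n\<ge>M. dist (ell1_apply (X m) g) (ell1_apply (X n) g) < e"
    proof (intro exI[of _ M] allI impI)
      fix m n assume "m \<ge> M" "n \<ge> M"
      have "dist (ell1_apply (X m) g) (ell1_apply (X n) g) \<le> dist (X m) (X n)"
        using abs_ell1_apply_le[of "X m - X n" g] by (simp add: dist_norm minus_ell1.rep_eq)
      also have "\<dots> < e" by (rule M) fact+
      finally show "dist (ell1_apply (X m) g) (ell1_apply (X n) g) < e" .
    qed
  qed
  define L where "L g = lim (\<lambda>n. ell1_apply (X n) g)" for g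
  have L: "(\<lambda>n. ell1_apply (X n) g) \<longlonglongrightarrow> L g" for g
    unfolding L_def by (intro convergent_LIMSEQ_iff[THEN iffD1] Cauchy_convergent) fact
  have tail: "\<exists>M. \<forall>n\<ge>M. \<forall>F. finite F \<longrightarrow> (\<Sum>g\<in>F. \<bar>ell1_apply (X n) g - L g\<bar>) \<le> e"
    if "e > 0" for e
  proof -
    obtain M where M: "\<And>m n. m \<ge> M \<Longrightarrow> n \<ge> M \<Longrightarrow> dist (X m) (X n) < e"
      using X \<open>e > 0\<close> unfolding Cauchy_def by blast
    show ?thesis
    proof (intro exI[of _ M] allI impI)
      fix n and F :: "'a set" assume n: "n \<ge> M" and F: "finite F"
      have lim: "(\<lambda>m. \<Sum>g\<in>F. \<bar>ell1_apply (X n) g - ell1_apply (X m) g\<bar>)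
          \<longlonglongrightarrow> (\<Sum>g\<in>F. \<bar>ell1_apply (X n) g - L g\<bar>)"
        by (intro tendsto_intros L)
      have "(\<Sum>g\<in>F. \<bar>ell1_apply (X n) g - ell1_apply (X m) g\<bar>) \<le> e" if m: "m \<ge> M" for m
      proof -
        have "(\<Sum>g\<in>F. \<bar>ell1_apply (X n - X m) g\<bar>) \<le> norm (X n - X m)"
          unfolding norm_ell1.rep_eq
          using ell1_apply[of "X n - X m"] F by (intro finite_sum_le_infsum) auto
        then show ?thesis
          using M[OF n m] by (simp add: dist_norm minus_ell1.rep_eq)
      qed
      then show "(\<Sum>g\<in>F. \<bar>ell1_apply (X n) g - L g\<bar>) \<le> e"
        by (intro tendsto_upperbound[OF lim]) (auto simp: eventually_sequentially)
    qed
  qed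
  have diff_summable: "(\<lambda>g. ell1_apply (X n) g - L g) summable_on UNIV"
    if "\<forall>F. finite F \<longrightarrow> (\<Sum>g\<in>F. \<bar>ell1_apply (X n) g - L g\<bar>) \<le> e" for n e
    by (rule summable_abs_iff[THEN iffD1], rule nonneg_bdd_above_summable_on)
      (use that in \<open>auto intro!: bdd_aboveI2[of _ _ e]\<close>)
  obtain N where "\<forall>F. finite F \<longrightarrow> (\<Sum>g\<in>F. \<bar>ell1_apply (X N) g - L g\<bar>) \<le> 1"
    using tail[of 1] by auto
  note d = diff_summable[OF this]
  have "ell1_apply (X N) summable_on UNIV"
    using ell1_apply[of "X N"] by (simp add: summable_abs_iff)
  from summable_diff[OF this d] have "L summable_on UNIV"
    by simp
  then have "(\<lambda>g. \<bar>L g\<bar>) summable_on UNIV"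
    by (simp add: summable_abs_iff)
  then have AbsL: "ell1_apply (Abs_ell1 L) = L"
    by (simp add: Abs_ell1_inverse)
  have "X \<longlonglongrightarrow> Abs_ell1 L"
  proof (rule metric_LIMSEQ_I)
    fix e :: real assume "e > 0"
    then obtain M where M: "\<forall>n\<ge>M. \<forall>F. finite F \<longrightarrow> (\<Sum>g\<in>F. \<bar>ell1_apply (X n) g - L g\<bar>) \<le> e / 2"
      using tail[of "e / 2"] by auto
    have "dist (X n) (Abs_ell1 L) < e" if n: "n \<ge> M" for n
    proof -
      have "(\<Sum>\<^sub>\<infinity>g. \<bar>ell1_apply (X n) g - L g\<bar>) \<le> e / 2"
        using M n diff_summable[of n "e / 2"]
        by (intro infsum_le_finite_sums) (auto simp: summable_abs_iff)
      then show ?thesis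
        using \<open>e > 0\<close> by (simp add: dist_norm norm_ell1.rep_eq minus_ell1.rep_eq AbsL)
    qed
    then show "\<exists>M. \<forall>n\<ge>M. dist (X n) (Abs_ell1 L) < e" by blast
  qed
  then show "convergent X" by (auto simp: convergent_def)
qed

text \<open>The group is written additively, although it need not be commutative:
  \<^class>\<open>group_add\<close> is the library's class of arbitrary groups.
  Thus \<open>- h + g\<close> below stands for $h^{-1}g$.\<close>

definition convolution :: "('g::group_add \<Rightarrow> real) \<Rightarrow> ('g \<Rightarrow> real) \<Rightarrow> 'g \<Rightarrow> real" where
  "convolution a b g = (\<Sum>\<^sub>\<infinity>h. a h * b (- h + g))"

lemma bij_shift: "bij (\<lambda>g::'g::group_add. - h + g)"
  by (rule bij_betw_byWitness[where f' = "\<lambda>g. h + g"]) (auto simp: add.assoc[symmetric])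

lemma infsum_shift: "(\<Sum>\<^sub>\<infinity>g. f (- h + g)) = (\<Sum>\<^sub>\<infinity>g. f (g::'g::group_add))"
  by (rule infsum_reindex_bij_betw[OF bij_shift])

lemma summable_shift: "(\<lambda>g. f (- h + g)) summable_on UNIV \<longleftrightarrow> f summable_on (UNIV :: 'g::group_add set)"
  by (rule summable_on_reindex_bij_betw[OF bij_shift])

lemma convolution_summable_pairs:
  fixes a b :: "'g::group_add \<Rightarrow> real"
  assumes a: "a summable_on UNIV" and b: "b summable_on UNIV"
  shows "(\<lambda>(h, g). a h * b (- h + g)) summable_on UNIV \<times> UNIV"
proof -
  have *: "(\<lambda>g. \<bar>b (- h + g)\<bar>) summable_on UNIV" for h
    using b summable_shift[of b h] by (simp add: summable_abs_iff)
  have "(\<lambda>x. \<bar>case x of (h, g) \<Rightarrow> a h * b (- h + g)\<bar>) summable_on UNIV \<times> UNIV"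
  proof (rule summable_on_SigmaI[where g = "\<lambda>h. \<bar>a h\<bar> * (\<Sum>\<^sub>\<infinity>g. \<bar>b g\<bar>)"])
    show "((\<lambda>g. \<bar>case (h, g) of (h, g) \<Rightarrow> a h * b (- h + g)\<bar>) has_sum \<bar>a h\<bar> * (\<Sum>\<^sub>\<infinity>g. \<bar>b g\<bar>)) UNIV"
      for h
      using has_sum_cmult_right[OF has_sum_infsum[OF *[of h]], of "\<bar>a h\<bar>"]
      by (simp add: abs_mult infsum_shift[of "\<lambda>g. \<bar>b g\<bar>"])
    show "(\<lambda>h. \<bar>a h\<bar> * (\<Sum>\<^sub>\<infinity>g. \<bar>b g\<bar>)) summable_on UNIV"
      using a by (intro summable_on_cmult_left) (simp add: summable_abs_iff)
  qed auto
  then show ?thesis by (simp only: summable_abs_iff)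
qed

lemma convolution_summable_pairs':
  fixes a b :: "'g::group_add \<Rightarrow> real"
  assumes a: "a summable_on UNIV" and b: "b summable_on UNIV"
  shows "(\<lambda>(g, h). a h * b (- h + g)) summable_on UNIV \<times> UNIV"
  using summable_on_swap[of "\<lambda>(h, g). a h * b (- h + g)" UNIV UNIV] convolution_summable_pairs[OF a b]
  by (simp add: case_prod_unfold)

lemma convolution_row_summable:
  fixes a b :: "'g::group_add \<Rightarrow> real"
  assumes "a summable_on UNIV" and "b summable_on UNIV"
  shows "(\<lambda>h. a h * b (- h + g)) summable_on UNIV"
  using summable_on_SigmaD1[OF convolution_summable_pairs'[OF assms], of g] by simp

lemma convolution_summable:
  fixes a b :: "'g::group_add \<Rightarrow> real"
  assumes "a summable_on UNIV" and "b summable_on UNIV"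
  shows "convolution a b summable_on UNIV"
  using summable_on_Sigma_banach[OF convolution_summable_pairs'[OF assms]]
  by (simp add: convolution_def[abs_def])

lemma convolution_norm_le:
  fixes a b :: "'g::group_add \<Rightarrow> real"
  assumes a: "a summable_on UNIV" and b: "b summable_on UNIV"
  shows "(\<Sum>\<^sub>\<infinity>g. \<bar>convolution a b g\<bar>) \<le> (\<Sum>\<^sub>\<infinity>g. \<bar>a g\<bar>) * (\<Sum>\<^sub>\<infinity>g. \<bar>b g\<bar>)"
proof -
  let ?a = "\<lambda>g. \<bar>a g\<bar>" and ?b = "\<lambda>g. \<bar>b g\<bar>"
  have a': "?a summable_on UNIV" and b': "?b summable_on UNIV"
    using a b by (simp_all add: summable_abs_iff)
  have "\<bar>convolution a b g\<bar> \<le> convolution ?a ?b g" for g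
    using norm_infsum_bound[of "\<lambda>h. a h * b (- h + g)" UNIV] convolution_row_summable[OF a b, of g]
    by (simp add: convolution_def abs_mult[symmetric] summable_abs_iff)
  then have "(\<Sum>\<^sub>\<infinity>g. \<bar>convolution a b g\<bar>) \<le> (\<Sum>\<^sub>\<infinity>g. convolution ?a ?b g)"
    using convolution_summable[OF a b] convolution_summable[OF a' b']
    by (intro infsum_mono) (auto simp: summable_abs_iff)
  also have "\<dots> = (\<Sum>\<^sub>\<infinity>h. \<Sum>\<^sub>\<infinity>g. ?a h * ?b (- h + g))"
    unfolding convolution_def
    by (rule infsum_swap_banach[OF convolution_summable_pairs'[OF a' b']])
  also have "\<dots> = (\<Sum>\<^sub>\<infinity>h. ?a h * (\<Sum>\<^sub>\<infinity>g. ?b g))"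
    by (simp only: infsum_cmult_right' infsum_shift[of ?b])
  also have "\<dots> = (\<Sum>\<^sub>\<infinity>g. \<bar>a g\<bar>) * (\<Sum>\<^sub>\<infinity>g. \<bar>b g\<bar>)"
    by (rule infsum_cmult_left')
  finally show ?thesis .
qed

lemma convolution_assoc:
  fixes a b c :: "'g::group_add \<Rightarrow> real"
  assumes a: "a summable_on UNIV" and b: "b summable_on UNIV" and c: "c summable_on UNIV"
  shows "convolution (convolution a b) c = convolution a (convolution b c)"
proof
  fix g
  have bdd: "\<bar>c x\<bar> \<le> (\<Sum>\<^sub>\<infinity>g. \<bar>c g\<bar>)" for x
    using finite_sum_le_infsum[of "\<lambda>g. \<bar>c g\<bar>" UNIV "{x}"] c by (simp add: summable_abs_iff)
  have "(\<lambda>(k, h). (a h * b (- h + k)) * c (- k + g)) summable_on UNIV \<times> UNIV"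
  proof -
    have "(\<lambda>p. \<bar>case p of (k, h) \<Rightarrow> a h * b (- h + k)\<bar> * (\<Sum>\<^sub>\<infinity>g. \<bar>c g\<bar>)) summable_on UNIV \<times> UNIV"
      using convolution_summable_pairs'[OF a b]
      by (intro summable_on_cmult_left) (simp only: summable_abs_iff)
    then have "(\<lambda>p. \<bar>case p of (k, h) \<Rightarrow> (a h * b (- h + k)) * c (- k + g)\<bar>) summable_on UNIV \<times> UNIV"
      by (rule summable_on_comparison_test) (auto simp: abs_mult intro!: mult_left_mono bdd)
    then show ?thesis by (simp only: summable_abs_iff)
  qed
  note pairs = this
  have "convolution (convolution a b) c g = (\<Sum>\<^sub>\<infinity>k. \<Sum>\<^sub>\<infinity>h. (a h * b (- h + k)) * c (- k + g))"
    by (simp add: convolution_def infsum_cmult_left')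
  also have "\<dots> = (\<Sum>\<^sub>\<infinity>h. \<Sum>\<^sub>\<infinity>k. (a h * b (- h + k)) * c (- k + g))"
    by (rule infsum_swap_banach[OF pairs])
  also have "\<dots> = (\<Sum>\<^sub>\<infinity>h. a h * (\<Sum>\<^sub>\<infinity>k. b (- h + k) * c (- (- h + k) + (- h + g))))"
    by (simp add: infsum_cmult_right' mult.assoc minus_add add.assoc)
  also have "\<dots> = (\<Sum>\<^sub>\<infinity>h. a h * (\<Sum>\<^sub>\<infinity>k. b k * c (- k + (- h + g))))"
    by (subst infsum_shift[of "\<lambda>k. b k * c (- k + (- _ + g))"]) simp
  also have "\<dots> = convolution a (convolution b c) g"
    by (simp add: convolution_def)
  finally show "convolution (convolution a b) c g = convolution a (convolution b c) g" .
qed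

instantiation ell1 :: (group_add) real_normed_algebra
begin

lift_definition times_ell1 :: "'a ell1 \<Rightarrow> 'a ell1 \<Rightarrow> 'a ell1" is convolution
  by (simp add: summable_abs_iff convolution_summable)

instance
proof
  fix x y z :: "'a ell1" and r :: real
  show "x * y * z = x * (y * z)"
    by transfer (simp add: summable_abs_iff convolution_assoc)
  show "(x + y) * z = x * z + y * z"
    by transfer (simp add: summable_abs_iff convolution_def[abs_def] distrib_right infsum_add
        convolution_row_summable)
  show "x * (y + z) = x * y + x * z"
    by transfer (simp add: summable_abs_iff convolution_def[abs_def] distrib_left infsum_add
        convolution_row_summable)
  show "r *\<^sub>R x * y = r *\<^sub>R (x * y)"
    by transfer (simp add: convolution_def[abs_def] mult.assoc infsum_cmult_right')
  show "x * r *\<^sub>R y = r *\<^sub>R (x * y)"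
    by transfer (simp add: convolution_def[abs_def] mult.left_commute infsum_cmult_right')
  show "norm (x * y) \<le> norm x * norm y"
    by transfer (simp add: summable_abs_iff convolution_norm_le)
qed

end


section \<open>Characteristic functions and two-valued measures\<close>

text \<open>The characteristic function of \<open>X\<close>, seen as an element of the dual of $\ell^1(G)$
  under the pairing $\langle\varphi,a\rangle=\sum_g a(g)\varphi(g)$.\<close>

lift_definition char_functional :: "'g set \<Rightarrow> ('g ell1 \<Rightarrow>\<^sub>L real)"
  is "\<lambda>X a. \<Sum>\<^sub>\<infinity>g. ell1_apply a g * indicator X g"
proof -
  fix X :: "'g set"
  have s: "(\<lambda>g. \<bar>ell1_apply a g * indicator X g\<bar>) summable_on UNIV" for a
    by (rule summable_on_comparison_test[where f = "\<lambda>g. \<bar>ell1_apply a g\<bar>"])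
      (use ell1_apply[of a] in \<open>auto split: split_indicator\<close>)
  note s' = s[unfolded summable_abs_iff]
  show "bounded_linear (\<lambda>a. \<Sum>\<^sub>\<infinity>g. ell1_apply a g * indicator X g)"
  proof (rule bounded_linear_intro[where K = 1])
    fix a b :: "'g ell1" and r :: real
    show "(\<Sum>\<^sub>\<infinity>g. ell1_apply (a + b) g * indicator X g) =
        (\<Sum>\<^sub>\<infinity>g. ell1_apply a g * indicator X g) + (\<Sum>\<^sub>\<infinity>g. ell1_apply b g * indicator X g)"
      by (simp add: plus_ell1.rep_eq distrib_right infsum_add s')
    show "(\<Sum>\<^sub>\<infinity>g. ell1_apply (r *\<^sub>R a) g * indicator X g) =
        r *\<^sub>R (\<Sum>\<^sub>\<infinity>g. ell1_apply a g * indicator X g)"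
      by (simp add: scaleR_ell1.rep_eq mult.assoc infsum_cmult_right')
    have "norm (\<Sum>\<^sub>\<infinity>g. ell1_apply a g * indicator X g) \<le> (\<Sum>\<^sub>\<infinity>g. \<bar>ell1_apply a g * indicator X g\<bar>)"
      using norm_infsum_bound[of "\<lambda>g. ell1_apply a g * indicator X g" UNIV] s[of a] by simp
    also have "\<dots> \<le> (\<Sum>\<^sub>\<infinity>g. \<bar>ell1_apply a g\<bar>)"
      using s[of a] ell1_apply[of a] by (intro infsum_mono) (auto split: split_indicator)
    finally show "norm (\<Sum>\<^sub>\<infinity>g. ell1_apply a g * indicator X g) \<le> norm a * 1"
      by (simp add: norm_ell1.rep_eq)
  qed
qed

text \<open>The finitely additive measure on all subsets of \<open>G\<close> that represents an element of the
  bidual: since the bidual element acts on bounded functions by integration, the measure of \<open>A\<close>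
  is its value at $1_A$.\<close>

definition fa_measure :: "(('g ell1 \<Rightarrow>\<^sub>L real) \<Rightarrow>\<^sub>L real) \<Rightarrow> 'g set \<Rightarrow> real" where
  "fa_measure \<mu> A = blinfun_apply \<mu> (char_functional A)"

lemma fa_measure_additive:
  assumes "A \<inter> B = {}"
  shows "fa_measure \<mu> (A \<union> B) = fa_measure \<mu> A + fa_measure \<mu> B"
proof -
  have s: "(\<lambda>g. ell1_apply a g * indicator X g) summable_on UNIV" for a :: "'g ell1" and X
    by (rule summable_abs_iff[THEN iffD1], rule summable_on_comparison_test[where f = "\<lambda>g. \<bar>ell1_apply a g\<bar>"])
      (use ell1_apply[of a] in \<open>auto split: split_indicator\<close>)
  have "char_functional (A \<union> B) = char_functional A + char_functional B"
    by (rule blinfun_eqI)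
      (simp add: char_functional.rep_eq plus_blinfun.rep_eq indicator_add[OF assms, symmetric]
        distrib_left infsum_add s)
  then show ?thesis by (simp add: fa_measure_def blinfun.add_right)
qed

definition two_valued_measures :: "(('g ell1 \<Rightarrow>\<^sub>L real) \<Rightarrow>\<^sub>L real) set"  ("\<GG>") where
  "\<GG> = {\<omega>. fa_measure \<omega> UNIV = 1 \<and> (\<forall>A. fa_measure \<omega> A \<in> {0, 1})}"

end

theory Submission
  imports Defs
begin

text \<open>Write \<open>t \<omega>\<close> for the set of all \<open>h\<close> at which the function \<open>\<omega> \<circledast>\<circledast> 1\<^sub>X\<close> takes the value \<open>1\<close>; it
  determines \<open>\<omega> \<circledast>\<circledast> 1\<^sub>X\<close>, and functions belonging to different sets have distance \<open>1\<close>.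

  If the sets \<open>t \<omega>\<close> form an uncountable family, it contains a nonempty \<open>P\<close> without isolated
  points. By Zorn's lemma there is a minimal weak-star compact \<open>A\<close> with \<open>P \<subseteq> t(A)\<close>. Fragmentedness
  gives a weak-star open set that meets \<open>A\<close> and on whose trace in \<open>A\<close> the map \<open>t\<close> is constant;
  removing it from \<open>A\<close> loses at most one point of \<open>P\<close>, and none by compactness, since that point
  is a limit of others. This contradicts minimality.

  Conversely, enumerate the sets \<open>t \<omega>\<close> as \<open>Y\<^sub>0, Y\<^sub>1, \<dots>\<close>. Given a finitely additive \<open>\<mu>\<close>, choose around
  each \<open>Y\<^sub>j\<close> a cylinder whose \<open>\<mu>\<close>-variation is within \<open>\<epsilon>/2\<^sup>j\<^sup>+\<^sup>1\<close> of the infimum over all cylinders around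
  \<open>Y\<^sub>j\<close>. Finitely many of them cover \<open>G\<close>, so \<open>\<mu> \<circledast>\<circledast> 1\<^sub>X\<close> is uniformly \<open>\<epsilon>\<close>-close to a linear
  combination of the \<open>Y\<^sub>j\<close>. Hence the image of the dual ball is norm separable, and the Baire
  category theorem yields fragmentedness.\<close>

section \<open>The weak-star topology\<close>

lemma openin_weak_star_eval:
  assumes "open S"
  shows "openin weak_star_topology {\<psi> :: 'v::real_normed_vector \<Rightarrow>\<^sub>L real. \<psi> x \<in> S}"
  using strong_operator_topology_basis[of "{()}" "\<lambda>_. S" "\<lambda>_. x"] assms by simp

lemma Hausdorff_weak_star:
  "Hausdorff_space (weak_star_topology :: ('v::real_normed_vector \<Rightarrow>\<^sub>L real) topology)"
  unfolding Hausdorff_space_def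
proof (intro allI impI)
  fix \<phi> \<psi> :: "'v \<Rightarrow>\<^sub>L real"
  assume "\<phi> \<in> topspace weak_star_topology \<and> \<psi> \<in> topspace weak_star_topology \<and> \<phi> \<noteq> \<psi>"
  then obtain x where "\<phi> x \<noteq> \<psi> x"
    using blinfun_eqI by blast
  then obtain U V where UV: "open U" "open V" "\<phi> x \<in> U" "\<psi> x \<in> V" "U \<inter> V = {}"
    using hausdorff by metis
  show "\<exists>U V. openin weak_star_topology U \<and> openin weak_star_topology V \<and>
      \<phi> \<in> U \<and> \<psi> \<in> V \<and> disjnt U V"
    using UV
    by (intro exI[of _ "{f. blinfun_apply f x \<in> U}"] exI[of _ "{f. blinfun_apply f x \<in> V}"] conjI
        openin_weak_star_eval) (auto simp: disjnt_def)
qed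

lemma closedin_weak_star_eval:
  assumes "closed S"
  shows "closedin weak_star_topology {\<psi> :: 'v::real_normed_vector \<Rightarrow>\<^sub>L real. \<psi> x \<in> S}"
  using closedin_continuous_map_preimage[OF strong_operator_topology_continuous_evaluation, of S x]
    assms
  by (simp add: strong_operator_topology_topspace)

lemma closedin_weak_star_Ball:
  assumes "\<And>i. i \<in> I \<Longrightarrow> closed (S i)"
  shows "closedin weak_star_topology {\<psi> :: 'v::real_normed_vector \<Rightarrow>\<^sub>L real. \<forall>i\<in>I. \<psi> (x i) \<in> S i}"
proof (cases "I = {}")
  case True
  then show ?thesis
    using closedin_topspace[of weak_star_topology]
    by (simp add: strong_operator_topology_topspace)
next
  case False
  have "{\<psi> :: 'v \<Rightarrow>\<^sub>L real. \<forall>i\<in>I. \<psi> (x i) \<in> S i} = \<Inter> ((\<lambda>i. {\<psi>. blinfun_apply \<psi> (x i) \<in> S i}) ` I)"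
    by auto
  then show ?thesis
    using False assms by (auto intro!: closedin_Inter closedin_weak_star_eval)
qed

text \<open>By Tychonoff the product of the intervals of radius \<open>norm x\<close> is compact,
  and linearity is a closed condition in it. \<open>Blinfun\<close> carries the resulting compact
  set continuously onto the dual ball.\<close>

lemma Banach_Alaoglu:
  "compactin weak_star_topology (cball (0 :: 'v::real_normed_vector \<Rightarrow>\<^sub>L real) 1)"
proof -
  define P where "P = (PiE UNIV (\<lambda>x. cball 0 (norm x)) :: ('v \<Rightarrow> real) set)"
  define L where "L = P \<inter> {f. linear f}"
  have "compactin (product_topology (\<lambda>_. euclidean) UNIV) P"
    unfolding P_def by (simp add: compactin_PiE)
  then have "compact P"
    by (simp add: euclidean_product_topology)
  have cont: "continuous_on UNIV (\<lambda>f :: 'v \<Rightarrow> real. f x)" for x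
    by (rule continuous_on_product_coordinates)
  have "closed {f :: 'v \<Rightarrow> real. linear f}"
  proof -
    have "{f :: 'v \<Rightarrow> real. linear f} =
        (\<Inter>x. \<Inter>y. {f. f (x + y) = f x + f y}) \<inter> (\<Inter>r. \<Inter>x. {f. f (r *\<^sub>R x) = r * f x})"
      by (auto simp: linear_iff)
    also have "closed \<dots>"
      by (intro closed_Int closed_INT ballI closed_Collect_eq continuous_intros cont)
    finally show ?thesis .
  qed
  with \<open>compact P\<close> have "compact L"
    unfolding L_def by (rule compact_Int_closed)
  have bl: "bounded_linear f" "norm (Blinfun f) \<le> 1" if "f \<in> L" for f
  proof -
    have f: "linear f" "\<And>x. norm (f x) \<le> 1 * norm x"
      using that by (auto simp: L_def P_def PiE_iff)
    then show "bounded_linear f"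
      by (intro linear_conv_bounded_linear[THEN iffD2] bounded_linear_intro[where K = 1])
        (auto simp: linear_add linear_scale)
    then show "norm (Blinfun f) \<le> 1"
      using f by (intro norm_blinfun_bound) (auto simp: bounded_linear_Blinfun_apply)
  qed
  have "continuous_map (top_of_set L) weak_star_topology Blinfun"
    unfolding continuous_on_strong_operator_topo_iff_coordinatewise
  proof (intro allI)
    fix x
    have "continuous_on L (\<lambda>f. f x)"
      using cont continuous_on_subset by blast
    then have "continuous_on L (\<lambda>f. blinfun_apply (Blinfun f) x)"
      by (rule continuous_on_eq) (simp add: bl bounded_linear_Blinfun_apply)
    then show "continuous_map (top_of_set L) euclidean (\<lambda>f. blinfun_apply (Blinfun f) x)"
      by simp
  qed
  moreover have "compactin (top_of_set L) L"
    using \<open>compact L\<close> by (simp add: compactin_subtopology)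
  ultimately have "compactin weak_star_topology (Blinfun ` L)"
    by (rule image_compactin[rotated])
  moreover have "Blinfun ` L = cball 0 1"
  proof
    show "Blinfun ` L \<subseteq> cball 0 1"
      using bl by auto
    show "cball 0 1 \<subseteq> Blinfun ` L"
    proof
      fix \<psi> :: "'v \<Rightarrow>\<^sub>L real"
      assume "\<psi> \<in> cball 0 1"
      then have "\<bar>\<psi> x\<bar> \<le> norm x" for x
        using norm_blinfun[of \<psi> x] mult_right_mono[of "norm \<psi>" 1 "norm x"] by auto
      then have "blinfun_apply \<psi> \<in> L"
        by (auto simp: L_def P_def PiE_iff bounded_linear.linear blinfun.bounded_linear_right)
      then show "\<psi> \<in> Blinfun ` L"
        by (metis blinfun_apply_inverse image_eqI)
    qed
  qed
  ultimately show ?thesis by simp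
qed

lemma closedin_weak_star_cball:
  "closedin weak_star_topology (cball (0 :: 'v::real_normed_vector \<Rightarrow>\<^sub>L real) 1)"
  by (rule compactin_imp_closedin[OF Hausdorff_weak_star Banach_Alaoglu])


section \<open>Fragmented families\<close>

text \<open>Baire category: \<open>approx\<close> makes the dual ball separable for the uniform
  distance on \<open>S\<close>, so countably many weak-star closed sets of small oscillation cover
  any compact part of it, and one of them has interior.\<close>

lemma fragmented_familyI_countable:
  fixes S :: "'i \<Rightarrow> 'v::real_normed_vector" and Z :: "('i \<Rightarrow> real) set"
  assumes Z: "countable Z"
    and approx: "\<And>(\<psi> :: 'v \<Rightarrow>\<^sub>L real) e. \<lbrakk>norm \<psi> \<le> 1; e > 0\<rbrakk> \<Longrightarrow> \<exists>z\<in>Z. \<forall>i\<in>I. \<bar>blinfun_apply \<psi> (S i) - z i\<bar> \<le> e"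
  shows "fragmented_family (S ` I)"
  unfolding fragmented_family_def
proof (intro allI impI)
  fix A :: "('v \<Rightarrow>\<^sub>L real) set" and e :: real
  assume "A \<noteq> {} \<and> A \<subseteq> cball 0 1 \<and> e > 0"
  then have A: "A \<noteq> {}" "A \<subseteq> cball 0 1" and e: "e > 0" by auto
  \<comment> \<open>\<open>A\<close> is arbitrary; its closure is compact Hausdorff, so the Baire
    theorem applies there.\<close>
  define K where "K = weak_star_topology closure_of A"
  define T where "T = subtopology weak_star_topology K"
  \<comment> \<open>Radius \<open>e / 4\<close> bounds the final diameter by \<open>e / 2\<close>,
    which is strictly below \<open>e\<close>.\<close>
  define B where "B z = {\<psi> \<in> K. \<forall>i\<in>I. \<bar>blinfun_apply \<psi> (S i) - z i\<bar> \<le> e / 4}" for z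
  have "closedin weak_star_topology K"
    by (simp add: K_def)
  have AK: "A \<subseteq> K"
    unfolding K_def by (rule closure_of_subset) (simp add: strong_operator_topology_topspace)
  have K1: "K \<subseteq> cball 0 1"
    unfolding K_def by (rule closure_of_minimal[OF A(2) closedin_weak_star_cball])
  have topT: "topspace T = K"
    by (simp add: T_def strong_operator_topology_topspace)
  have "compact_space T"
    unfolding T_def using closed_compactin[OF Banach_Alaoglu K1 \<open>closedin _ K\<close>]
    by (rule compact_space_subtopology)
  moreover have "Hausdorff_space T"
    unfolding T_def by (rule Hausdorff_space_subtopology[OF Hausdorff_weak_star])
  ultimately have T: "locally_compact_space T" "regular_space T"
    by (auto intro: compact_imp_locally_compact_space compact_Hausdorff_imp_regular_space)
  have closed_B: "closedin T (B z)" for z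
  proof -
    have "closedin weak_star_topology {\<psi> :: 'v \<Rightarrow>\<^sub>L real. \<forall>i\<in>I. \<psi> (S i) \<in> cball (z i) (e / 4)}"
      by (rule closedin_weak_star_Ball) simp
    moreover have "B z = K \<inter> {\<psi>. \<forall>i\<in>I. blinfun_apply \<psi> (S i) \<in> cball (z i) (e / 4)}"
      by (auto simp: B_def dist_real_def abs_minus_commute)
    ultimately show ?thesis
      unfolding T_def closedin_subtopology by blast
  qed
  have "\<Union> (B ` Z) = topspace T"
  proof
    show "topspace T \<subseteq> \<Union> (B ` Z)"
    proof
      fix \<psi> assume "\<psi> \<in> topspace T"
      then show "\<psi> \<in> \<Union> (B ` Z)"
        using approx[of \<psi> "e / 4"] K1 e by (auto simp: topT B_def)
    qed
  qed (auto simp: B_def topT)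
  then have "T interior_of \<Union> (B ` Z) \<noteq> {}"
    using A(1) AK by (metis interior_of_topspace topT subset_empty)
  then obtain z where "T interior_of (B z) \<noteq> {}"
    using Baire_category_alt[of T "B ` Z"] T Z closed_B by (metis countable_image imageE)
  then obtain V where V: "openin T V" "V \<noteq> {}" "V \<subseteq> B z"
    by (metis interior_of_subset openin_interior_of)
  then obtain O' where O': "openin weak_star_topology O'" "V = O' \<inter> K"
    unfolding T_def openin_subtopology by blast
  \<comment> \<open>An open set that meets the closure of \<open>A\<close> meets \<open>A\<close>
    itself.\<close>
  have "O' \<inter> A \<noteq> {}"
    using V(2) O' openin_Int_closure_of_eq_empty[OF O'(1), of A] by (auto simp: K_def)
  moreover have "diameter ((\<lambda>\<psi>. blinfun_apply \<psi> x) ` (O' \<inter> A)) < e" if "x \<in> S ` I" for x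
  proof -
    obtain i where i: "i \<in> I" "x = S i" using \<open>x \<in> S ` I\<close> by blast
    have *: "\<bar>blinfun_apply \<psi> x - z i\<bar> \<le> e / 4" if "\<psi> \<in> O' \<inter> A" for \<psi>
      using that i V(3) O'(2) AK by (auto simp: B_def)
    have "diameter ((\<lambda>\<psi>. blinfun_apply \<psi> x) ` (O' \<inter> A)) \<le> e / 2"
    proof (rule diameter_le)
      fix u v assume "u \<in> (\<lambda>\<psi>. blinfun_apply \<psi> x) ` (O' \<inter> A)" "v \<in> (\<lambda>\<psi>. blinfun_apply \<psi> x) ` (O' \<inter> A)"
      then obtain \<psi> \<psi>' where "\<psi> \<in> O' \<inter> A" "\<psi>' \<in> O' \<inter> A" "u = blinfun_apply \<psi> x" "v = blinfun_apply \<psi>' x"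
        by blast
      then show "norm (u - v) \<le> e / 2"
        using *[of \<psi>] *[of \<psi>'] unfolding real_norm_def by linarith
    qed (use e in auto)
    then show ?thesis using e by simp
  qed
  ultimately show "\<exists>O'. openin weak_star_topology O' \<and> O' \<inter> A \<noteq> {} \<and>
      (\<forall>x\<in>S ` I. diameter ((\<lambda>\<psi>. blinfun_apply \<psi> x) ` (O' \<inter> A)) < e)"
    using O'(1) by blast
qed


text \<open>A perfect set argument in the space of subsets of \<open>'i\<close>, whose basic open
  sets are the cylinders over finite \<open>F\<close>. The value \<open>c\<close> is left general so
  that the lemma applies to functionals scaled into the unit ball.\<close>

lemma countable_traces_if_fragmented_family:
  fixes S :: "'i \<Rightarrow> 'v::real_normed_vector" and c :: real
  assumes fr: "fragmented_family C" and cI: "countable (UNIV :: 'i set)"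
    and SC: "range S \<subseteq> C" and c: "c > 0"
  shows "countable ((\<lambda>\<psi>. {i. blinfun_apply \<psi> (S i) = c}) `
      {\<psi> \<in> cball 0 1. \<forall>i. blinfun_apply \<psi> (S i) \<in> {0, c}})"
proof (rule ccontr)
  define t where "t \<psi> = {i. blinfun_apply \<psi> (S i) = c}" for \<psi>
  define K where "K = {\<psi> \<in> cball 0 1. \<forall>i. blinfun_apply \<psi> (S i) \<in> {0, c}}"
  define E where "E = t ` K"
  assume "\<not> ?thesis"
  then have E: "uncountable E"
    by (simp add: E_def K_def t_def[abs_def])
  \<comment> \<open>The part of \<open>E\<close> in the basic neighbourhood of \<open>Y\<close>
    given by the coordinates in \<open>F\<close>.\<close>
  define N where "N F Y = {Z \<in> E. Z \<inter> F = Y \<inter> F}" for F Y :: "'i set"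
  \<comment> \<open>the condensation points of \<open>E\<close>\<close>
  define P where "P = {Y \<in> E. \<forall>F. finite F \<longrightarrow> uncountable (N F Y)}"
  \<comment> \<open>As \<open>'i\<close> is countable, there are only countably many cylinders, and
    each point of \<open>E - P\<close> lies in one that contains countably many points of
    \<open>E\<close>.\<close>
  have "countable (E - P)"
  proof -
    define J where "J = {F :: 'i set. finite F}"
    have J: "countable J"
      unfolding J_def using countable_Collect_finite_subset[OF cI] by simp
    define Q where "Q = {(F, H). F \<in> J \<and> H \<in> J \<and> countable {Z \<in> E. Z \<inter> F = H}}"
    have "countable Q"
      by (rule countable_subset[of _ "J \<times> J"]) (auto simp: Q_def J)
    then have "countable (\<Union>(F, H)\<in>Q. {Z \<in> E. Z \<inter> F = H})"
      by (rule countable_UN) (auto simp: Q_def)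
    moreover have "E - P \<subseteq> (\<Union>(F, H)\<in>Q. {Z \<in> E. Z \<inter> F = H})"
    proof
      fix Y assume Y: "Y \<in> E - P"
      then obtain F where "finite F" "countable (N F Y)"
        by (auto simp: P_def)
      then have "(F, Y \<inter> F) \<in> Q"
        by (auto simp: Q_def J_def N_def)
      with Y show "Y \<in> (\<Union>(F, H)\<in>Q. {Z \<in> E. Z \<inter> F = H})"
        by blast
    qed
    ultimately show ?thesis
      by (intro countable_subset[of "E - P"])
  qed
  \<comment> \<open>\<open>P\<close> has no isolated points: an uncountable neighbourhood of
    \<open>Y\<close> survives the removal of the countable set \<open>E - P\<close> and of
    \<open>Y\<close>.\<close>
  then have another: "\<exists>Z\<in>P. Z \<noteq> Y \<and> Z \<inter> F = Y \<inter> F" if "Y \<in> P" "finite F" for Y F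
  proof -
    have "uncountable (N F Y - (E - P) - {Y})"
      using that \<open>countable (E - P)\<close> by (auto simp: P_def uncountable_minus_countable)
    then obtain Z where "Z \<in> N F Y - (E - P) - {Y}"
      by (metis countable_empty ex_in_conv)
    then show ?thesis by (auto simp: N_def)
  qed
  have "P \<noteq> {}"
    using E \<open>countable (E - P)\<close> by (metis Diff_empty)
  have "closedin weak_star_topology K"
  proof -
    have "K = cball 0 1 \<inter> {\<psi>. \<forall>i\<in>UNIV. blinfun_apply \<psi> (S i) \<in> {0, c}}"
      by (auto simp: K_def)
    also have "closedin weak_star_topology \<dots>"
      by (intro closedin_Int closedin_weak_star_cball closedin_weak_star_Ball) simp
    finally show ?thesis .
  qed
  then have "compactin weak_star_topology K"
    by (rule closed_compactin[OF Banach_Alaoglu, rotated]) (auto simp: K_def)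
  then have compact_Diff: "compactin weak_star_topology (K - U)"
    if "openin weak_star_topology U" for U
    using that by (metis Diff_subset closed_compactin closedin_diff \<open>closedin _ K\<close>)
  \<comment> \<open>On \<open>K\<close> only the values \<open>0\<close> and \<open>c\<close> occur,
    so an open half-line expresses that \<open>t \<psi>\<close> and \<open>Y\<close> differ at
    \<open>i\<close>.\<close>
  define W where "W i Y = {\<psi>. blinfun_apply \<psi> (S i) \<in> (if i \<in> Y then {..<c} else {0<..})}"
    for i and Y :: "'i set"
  have W: "openin weak_star_topology (W i Y)" "W i Y \<inter> K = {\<psi>\<in>K. (i \<in> t \<psi>) \<noteq> (i \<in> Y)}" for i Y
  proof -
    show "openin weak_star_topology (W i Y)"
      unfolding W_def by (rule openin_weak_star_eval) simp
    have "\<psi> \<in> W i Y \<longleftrightarrow> (i \<in> t \<psi>) \<noteq> (i \<in> Y)" if "\<psi> \<in> K" for \<psi>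
    proof -
      have "blinfun_apply \<psi> (S i) \<in> {0, c}" using that by (auto simp: K_def)
      then show ?thesis using c by (auto simp: W_def t_def)
    qed
    then show "W i Y \<inter> K = {\<psi>\<in>K. (i \<in> t \<psi>) \<noteq> (i \<in> Y)}" by blast
  qed
  \<comment> \<open>The image of the compact set \<open>K - U\<close> under \<open>t\<close> is
    closed: a point outside it is separated from it by finitely many coordinates.\<close>
  have finite_sep: "\<exists>F. finite F \<and> (\<forall>\<psi>\<in>K - U. t \<psi> \<inter> F \<noteq> Y \<inter> F)"
    if U: "openin weak_star_topology U" and Y: "Y \<notin> t ` (K - U)" for U Y
  proof -
    have "K - U \<subseteq> \<Union> (range (\<lambda>i. W i Y))"
    proof
      fix \<psi> assume \<psi>: "\<psi> \<in> K - U"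
      then have "t \<psi> \<noteq> Y" using Y by blast
      then obtain i where "(i \<in> t \<psi>) \<noteq> (i \<in> Y)" by blast
      with \<psi> have "\<psi> \<in> W i Y" using W(2)[of i Y] by blast
      then show "\<psi> \<in> \<Union> (range (\<lambda>i. W i Y))" by blast
    qed
    then obtain \<F> where "finite \<F>" "\<F> \<subseteq> range (\<lambda>i. W i Y)" "K - U \<subseteq> \<Union> \<F>"
      using compactinD[OF compact_Diff[OF U], of "range (\<lambda>i. W i Y)"] W(1) by blast
    then obtain F where F: "finite F" "K - U \<subseteq> (\<Union>i\<in>F. W i Y)"
      by (metis finite_subset_image)
    have "t \<psi> \<inter> F \<noteq> Y \<inter> F" if \<psi>: "\<psi> \<in> K - U" for \<psi>
    proof -
      obtain i where "i \<in> F" "\<psi> \<in> W i Y" using F \<psi> by blast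
      moreover have "\<psi> \<in> K" using \<psi> by blast
      ultimately show ?thesis using W(2)[of i Y] by blast
    qed
    then show ?thesis using F(1) by blast
  qed
  \<comment> \<open>Zorn's lemma is applied to the open complements: a maximal removable open set
    leaves a minimal compact set.\<close>
  define \<U> where "\<U> = {U. openin weak_star_topology U \<and> P \<subseteq> t ` (K - U)}"
  have "\<exists>M\<in>\<U>. \<forall>U\<in>\<U>. M \<subseteq> U \<longrightarrow> U = M"
  proof (rule subset_Zorn_nonempty)
    show "\<U> \<noteq> {}"
      by (auto simp: \<U>_def P_def E_def intro!: exI[of _ "{}"])
    fix \<C> assume "\<C> \<noteq> {}" and chain: "subset.chain \<U> \<C>"
    have op: "openin weak_star_topology (\<Union>\<C>)"
      using chain by (auto simp: subset.chain_def \<U>_def)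
    \<comment> \<open>If the union lost \<open>Y\<close>, it would contain the part of
      \<open>K\<close> lying over a whole cylinder around \<open>Y\<close>. That part is compact, so
      a single member of the chain would contain it and lose \<open>Y\<close> already.\<close>
    moreover have "Y \<in> t ` (K - \<Union>\<C>)" if "Y \<in> P" for Y
    proof (rule ccontr)
      assume "Y \<notin> t ` (K - \<Union>\<C>)"
      from finite_sep[OF op this] obtain F where
        F: "finite F" "\<And>\<psi>. \<psi> \<in> K - \<Union>\<C> \<Longrightarrow> t \<psi> \<inter> F \<noteq> Y \<inter> F" by blast
      have "openin weak_star_topology (\<Union>i\<in>F. W i Y)"
        using W(1) by blast
      note comp = compact_Diff[OF this]
      have "K - (\<Union>i\<in>F. W i Y) \<subseteq> \<Union>\<C>"
      proof
        fix \<psi> assume \<psi>: "\<psi> \<in> K - (\<Union>i\<in>F. W i Y)"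
        then have "t \<psi> \<inter> F = Y \<inter> F"
          using W(2)[of _ Y] by blast
        with F(2) \<psi> show "\<psi> \<in> \<Union>\<C>" by blast
      qed
      then obtain \<F> where \<F>: "finite \<F>" "\<F> \<subseteq> \<C>" "K - (\<Union>i\<in>F. W i Y) \<subseteq> \<Union> \<F>"
        using compactinD[OF comp, of \<C>] chain by (auto simp: subset.chain_def \<U>_def)
      have "\<exists>V\<in>\<C>. \<Union>\<F> \<subseteq> V"
      proof (cases "\<F> = {}")
        case True
        then show ?thesis using \<open>\<C> \<noteq> {}\<close> by blast
      next
        case False
        have "subset.chain \<U> \<F>"
          using chain \<F>(2) by (meson subset.chain_def subset_iff)
        then have "\<Union>\<F> \<in> \<F>"
          using \<F>(1) False Union_in_chain by blast
        then show ?thesis using \<F>(2) by blast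
      qed
      then obtain V where V: "V \<in> \<C>" "K - (\<Union>i\<in>F. W i Y) \<subseteq> V"
        using \<F>(3) by blast
      then have "Y \<in> t ` (K - V)"
        using chain that by (auto simp: subset.chain_def \<U>_def)
      then obtain \<psi> where \<psi>: "\<psi> \<in> K - V" "t \<psi> = Y" by blast
      then obtain i where "\<psi> \<in> W i Y" using V(2) by blast
      then show False using \<psi> W(2)[of i Y] by blast
    qed
    ultimately show "\<Union>\<C> \<in> \<U>" by (auto simp: \<U>_def)
  qed
  then obtain M where M: "M \<in> \<U>" and max: "\<And>U. U \<in> \<U> \<Longrightarrow> M \<subseteq> U \<Longrightarrow> U = M"
    by blast
  define A where "A = K - M"
  have PA: "P \<subseteq> t ` A" and opM: "openin weak_star_topology M"
    using M by (auto simp: A_def \<U>_def)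
  have "A \<noteq> {}" "A \<subseteq> cball 0 1"
    using PA \<open>P \<noteq> {}\<close> by (auto simp: A_def K_def)
  then obtain O' where O': "openin weak_star_topology O'" "O' \<inter> A \<noteq> {}"
    and diam: "\<And>x. x \<in> C \<Longrightarrow> diameter ((\<lambda>\<psi>. blinfun_apply \<psi> x) ` (O' \<inter> A)) < c"
    using fr c unfolding fragmented_family_def by meson
  \<comment> \<open>Fragmentedness is used with \<epsilon> equal to \<open>c\<close>, the gap
    between the two possible values.\<close>
  have same: "t \<psi> = t \<psi>'" if "\<psi> \<in> O' \<inter> A" "\<psi>' \<in> O' \<inter> A" for \<psi> \<psi>'
  proof -
    have "blinfun_apply \<psi> (S i) = blinfun_apply \<psi>' (S i)" for i
    proof -
      let ?R = "(\<lambda>\<psi>. blinfun_apply \<psi> (S i)) ` (O' \<inter> A)"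
      have sub: "?R \<subseteq> {0, c}" by (auto simp: A_def K_def)
      then have "bounded ?R" by (meson bounded_subset finite_imp_bounded finite.intros)
      then have "dist (blinfun_apply \<psi> (S i)) (blinfun_apply \<psi>' (S i)) \<le> diameter ?R"
        using that by (intro diameter_bounded_bound) auto
      also have "\<dots> < c" using diam SC by blast
      finally have "dist (blinfun_apply \<psi> (S i)) (blinfun_apply \<psi>' (S i)) < c" .
      moreover have "blinfun_apply \<psi> (S i) \<in> {0, c}" "blinfun_apply \<psi>' (S i) \<in> {0, c}"
        using sub that by blast+
      ultimately show ?thesis using c by (auto simp: dist_real_def)
    qed
    then show ?thesis by (simp add: t_def)
  qed
  obtain \<psi>0 where \<psi>0: "\<psi>0 \<in> O' \<inter> A" using O'(2) by blast
  have op: "openin weak_star_topology (M \<union> O')"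
    using opM O'(1) by blast
  have rest: "Z \<in> t ` (K - (M \<union> O'))" if Z: "Z \<in> P" "Z \<noteq> t \<psi>0" for Z
  proof -
    obtain \<psi> where "\<psi> \<in> A" "Z = t \<psi>" using PA Z(1) by blast
    moreover have "\<psi> \<notin> O'"
    proof
      assume "\<psi> \<in> O'"
      then have "t \<psi> = t \<psi>0" using \<open>\<psi> \<in> A\<close> by (intro same[OF _ \<psi>0]) simp
      then show False using Z(2) \<open>Z = t \<psi>\<close> by simp
    qed
    ultimately show ?thesis unfolding A_def by blast
  qed
  \<comment> \<open>Only \<open>t \<psi>0\<close> could be lost. Other points of \<open>P\<close>
    agree with it on any finite \<open>F\<close>, and they all remain, which contradicts
    \<open>finite_sep\<close>.\<close>
  have "Y \<in> t ` (K - (M \<union> O'))" if Y: "Y \<in> P" for Y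
  proof (rule ccontr)
    assume no: "Y \<notin> t ` (K - (M \<union> O'))"
    from finite_sep[OF op this] obtain F where
      F: "finite F" "\<And>\<psi>. \<psi> \<in> K - (M \<union> O') \<Longrightarrow> t \<psi> \<inter> F \<noteq> Y \<inter> F" by blast
    from another[OF Y F(1)] obtain Z where "Z \<in> P" "Z \<noteq> Y" "Z \<inter> F = Y \<inter> F" by blast
    moreover have "Y = t \<psi>0" using rest[OF Y] no by blast
    ultimately have "Z \<in> t ` (K - (M \<union> O'))" using rest[of Z] by blast
    then show False using F(2) \<open>Z \<inter> F = Y \<inter> F\<close> by blast
  qed
  then have "M \<union> O' \<in> \<U>" using op unfolding \<U>_def by blast
  then have "O' \<subseteq> M" using max by blast
  then show False using \<psi>0 by (auto simp: A_def)
qed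


section \<open>Approximation of finitely additive set functions\<close>

text \<open>In the application \<open>D h\<close> is a translate of \<open>X\<close> and the
  \<open>Y j\<close> are the traces of two-valued measures; \<open>cover\<close> is the compactness
  of these measures, seen at points \<open>k\<close>. On a cylinder of nearly minimal variation,
  \<open>m\<close> hardly distinguishes \<open>D h\<close> from the whole cylinder if
  \<open>h \<in> Y j\<close>, or from the empty set otherwise.\<close>

lemma finitely_additive_approx:
  fixes m :: "'k set \<Rightarrow> real" and D :: "'i \<Rightarrow> 'k set" and Y :: "nat \<Rightarrow> 'i set"
  assumes add: "\<And>A B. A \<inter> B = {} \<Longrightarrow> m (A \<union> B) = m A + m B"
    and bound: "\<And>A. \<bar>m A\<bar> \<le> M"
    and cover: "\<And>F. (\<And>j. finite (F j)) \<Longrightarrow> \<exists>N. \<forall>k. \<exists>j<N. \<forall>h\<in>F j. k \<in> D h \<longleftrightarrow> h \<in> Y j"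
    and e: "e > 0"
  shows "\<exists>N c. \<forall>h. \<bar>m (D h) - (\<Sum>j<N. c j * indicator (Y j) h)\<bar> \<le> e"
proof -
  \<comment> \<open>unlike the supremum of \<open>\<bar>m W\<bar>\<close>, this form of the variation is superadditive\<close>
  define v where "v V = Sup {m W - m W' | W W'. W \<subseteq> V \<and> W' \<subseteq> V}" for V
  have bdd: "bdd_above {m W - m W' | W W'. W \<subseteq> V \<and> W' \<subseteq> V}" for V
  proof (rule bdd_aboveI[of _ "2 * M"])
    fix x assume "x \<in> {m W - m W' | W W'. W \<subseteq> V \<and> W' \<subseteq> V}"
    then obtain W W' where "x = m W - m W'" by blast
    then show "x \<le> 2 * M" using bound[of W] bound[of W'] by linarith
  qed
  have v_upper: "m W - m W' \<le> v V" if "W \<subseteq> V" "W' \<subseteq> V" for V W W'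
    unfolding v_def using that by (intro cSup_upper bdd) auto
  have m_empty: "m {} = 0"
    using add[of "{}" "{}"] by simp
  have abs_m: "\<bar>m W\<bar> \<le> v V" if "W \<subseteq> V" for V W
    using v_upper[of W V "{}"] v_upper[of "{}" V W] that by (simp add: m_empty)
  have v_nonneg: "v V \<ge> 0" for V
    using abs_m[of "{}" V] by simp
  \<comment> \<open>Competitors for \<open>V\<close> and \<open>V'\<close> unite to competitors for
    the union; the two suprema are taken one after the other.\<close>
  have v_super: "v V + v V' \<le> v (V \<union> V')" if "V \<inter> V' = {}" for V V'
  proof -
    have "m A - m B + (m A' - m B') \<le> v (V \<union> V')"
      if AB: "A \<subseteq> V" "B \<subseteq> V" "A' \<subseteq> V'" "B' \<subseteq> V'" for A B A' B'
    proof -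
      have "m (A \<union> A') = m A + m A'" "m (B \<union> B') = m B + m B'"
        using AB \<open>V \<inter> V' = {}\<close> by (intro add; blast)+
      then show ?thesis
        using v_upper[of "A \<union> A'" "V \<union> V'" "B \<union> B'"] AB by fastforce
    qed
    then have *: "m A - m B \<le> v (V \<union> V') - (m A' - m B')"
      if "A \<subseteq> V" "B \<subseteq> V" "A' \<subseteq> V'" "B' \<subseteq> V'" for A B A' B'
      using that by (smt (verit, best))
    have "v V \<le> v (V \<union> V') - (m A' - m B')" if "A' \<subseteq> V'" "B' \<subseteq> V'" for A' B'
      unfolding v_def[of V] by (rule cSup_least) (use * that in auto)
    then have **: "m A' - m B' \<le> v (V \<union> V') - v V" if "A' \<subseteq> V'" "B' \<subseteq> V'" for A' B'
      using that by (smt (verit, best))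
    have "v V' \<le> v (V \<union> V') - v V"
      unfolding v_def[of V'] by (rule cSup_least) (use ** in auto)
    then show ?thesis by simp
  qed
  define B where "B j F = {k. \<forall>h\<in>F. k \<in> D h \<longleftrightarrow> h \<in> Y j}" for j F
  \<comment> \<open>Adding a coordinate yields another cylinder, whose variation is at least the
    infimum, so a nearly minimal one loses at most the tolerance. The tolerances over all
    \<open>j\<close> sum to \<open>e\<close>.\<close>
  have "\<exists>F. finite F \<and> (\<forall>h. v (B j F) \<le> v (B j (insert h F)) + e * (1/2) ^ Suc j)" for j
  proof -
    define I where "I = (\<lambda>F. v (B j F)) ` {F. finite F}"
    have "I \<noteq> {}" by (auto simp: I_def)
    have "bdd_below I"
      by (rule bdd_belowI[of _ 0]) (auto simp: I_def v_nonneg)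
    have "Inf I < Inf I + e * (1/2) ^ Suc j" using e by simp
    then obtain x where "x \<in> I" "x < Inf I + e * (1/2) ^ Suc j"
      using cInf_lessD[OF \<open>I \<noteq> {}\<close>] by blast
    then obtain F where F: "finite F" "v (B j F) < Inf I + e * (1/2) ^ Suc j"
      by (auto simp: I_def)
    have "Inf I \<le> v (B j (insert h F))" for h
      using F(1) \<open>bdd_below I\<close> by (intro cInf_lower) (auto simp: I_def)
    with F show ?thesis by (intro exI[of _ F]) (smt (verit, best))
  qed
  then obtain F where F: "\<And>j. finite (F j)"
    "\<And>j h. v (B j (F j)) \<le> v (B j (insert h (F j))) + e * (1/2) ^ Suc j"
    by metis
  define U where "U j = B j (F j)" for j
  obtain N where N: "(\<Union>j<N. U j) = UNIV"
  proof -
    obtain N where "\<forall>k. \<exists>j<N. \<forall>h\<in>F j. k \<in> D h \<longleftrightarrow> h \<in> Y j"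
      using cover[of F, OF F(1)] by blast
    then have "(\<Union>j<N. U j) = UNIV" by (auto simp: U_def B_def)
    then show thesis by (rule that)
  qed
  \<comment> \<open>Disjoint pieces make \<open>m\<close> additive over the cover, and
    \<open>W j \<subseteq> U j\<close> preserves the variation estimates.\<close>
  define W where "W = disjointed U"
  have W_sub: "W j \<subseteq> U j" for j
    unfolding W_def by (rule disjointed_subset)
  have W_disj: "W i \<inter> W j = {}" if "i \<noteq> j" for i j
    using disjoint_family_disjointed[of U] that by (auto simp: W_def disjoint_family_on_def)
  have W_un: "(\<Union>j<N. W j) = UNIV"
    using N finite_UN_disjointed_eq[of U N] by (simp add: W_def atLeast0LessThan)
  have m_sum: "m (A \<inter> (\<Union>j<n. W j)) = (\<Sum>j<n. m (A \<inter> W j))" for A n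
  proof (induction n)
    case 0
    show ?case by (simp add: m_empty)
  next
    case (Suc n)
    have "W j \<inter> W n = {}" if "j < n" for j
      using that by (intro W_disj) simp
    then have "(A \<inter> (\<Union>j<n. W j)) \<inter> (A \<inter> W n) = {}"
      by blast
    note add[OF this]
    moreover have "A \<inter> (\<Union>j<Suc n. W j) = (A \<inter> (\<Union>j<n. W j)) \<union> (A \<inter> W n)"
      by (auto simp: less_Suc_eq)
    ultimately show ?case
      using Suc by simp
  qed
  \<comment> \<open>\<open>R\<close> collects the points of \<open>U j\<close> violating the
    condition at \<open>h\<close>. It contains \<open>W j - D h\<close> if
    \<open>h \<in> Y j\<close>, and \<open>D h \<inter> W j\<close> otherwise.\<close>
  have piece: "\<bar>m (D h \<inter> W j) - m (W j) * indicator (Y j) h\<bar> \<le> e * (1/2) ^ Suc j" for h j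
  proof -
    define R where "R = U j - B j (insert h (F j))"
    have "B j (insert h (F j)) \<subseteq> U j" by (auto simp: U_def B_def)
    then have "v R + v (B j (insert h (F j))) \<le> v (U j)"
      using v_super[of R "B j (insert h (F j))"] by (simp add: R_def Un_absorb2 Int_commute)
    then have R: "v R \<le> e * (1/2) ^ Suc j"
      using F(2)[of j h] by (simp add: U_def)
    show ?thesis
    proof (cases "h \<in> Y j")
      case True
      have "m (W j) = m (D h \<inter> W j) + m (W j - D h)"
        using add[of "W j \<inter> D h" "W j - D h"] by (simp add: Int_Diff_Un Int_Diff_disjoint Int_commute[of "D h"])
      moreover have "\<bar>m (W j - D h)\<bar> \<le> v R"
        by (rule abs_m) (use W_sub[of j] True in \<open>auto simp: R_def U_def B_def\<close>)
      ultimately show ?thesis using R True by simp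
    next
      case False
      have "\<bar>m (D h \<inter> W j)\<bar> \<le> v R"
        by (rule abs_m) (use W_sub[of j] False in \<open>auto simp: R_def U_def B_def\<close>)
      then show ?thesis using R False by simp
    qed
  qed
  have "\<bar>m (D h) - (\<Sum>j<N. m (W j) * indicator (Y j) h)\<bar> \<le> e" for h
  proof -
    have "m (D h) - (\<Sum>j<N. m (W j) * indicator (Y j) h) =
        (\<Sum>j<N. m (D h \<inter> W j) - m (W j) * indicator (Y j) h)"
      using m_sum[of "D h" N] by (simp add: W_un sum_subtractf)
    also have "\<bar>\<dots>\<bar> \<le> (\<Sum>j<N. e * (1/2) ^ Suc j)"
      by (rule order_trans[OF sum_abs sum_mono]) (rule piece)
    also have "\<dots> = e * (\<Sum>j<N. (1/2) ^ Suc j)"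
      by (simp add: sum_distrib_left)
    also have "\<dots> \<le> e * 1"
    proof (rule mult_left_mono)
      have "(\<Sum>j<N. (1/2 :: real) ^ Suc j) \<le> suminf (\<lambda>j. (1/2) ^ Suc j)"
        using power_half_series by (intro sum_le_suminf) (auto simp: sums_iff)
      then show "(\<Sum>j<N. (1/2 :: real) ^ Suc j) \<le> 1"
        using power_half_series by (simp add: sums_iff)
    qed (use e in simp)
    finally show ?thesis by simp
  qed
  then show ?thesis by (intro exI[of _ N] exI[of _ "\<lambda>j. m (W j)"]) blast
qed


section \<open>Functionals on the group algebra\<close>

lift_definition delta :: "'g \<Rightarrow> 'g ell1" is "\<lambda>h. indicator {h}"
proof -
  fix h :: 'g
  have "(\<lambda>g. \<bar>indicator {h} g :: real\<bar>) summable_on {h}" by simp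
  also have "?this \<longleftrightarrow> (\<lambda>g. \<bar>indicator {h} g :: real\<bar>) summable_on UNIV"
    by (rule summable_on_cong_neutral) auto
  finally show "(\<lambda>g. \<bar>indicator {h} g :: real\<bar>) summable_on UNIV" .
qed

lemma norm_delta [simp]: "norm (delta h) = 1"
proof -
  have "norm (delta h) = (\<Sum>\<^sub>\<infinity>g\<in>{h}. \<bar>indicator {h} g :: real\<bar>)"
    unfolding norm_ell1.rep_eq delta.rep_eq by (rule infsum_cong_neutral) auto
  then show ?thesis by simp
qed

lemma char_functional_delta [simp]: "blinfun_apply (char_functional X) (delta h) = indicator X h"
proof -
  have "blinfun_apply (char_functional X) (delta h) = (\<Sum>\<^sub>\<infinity>g\<in>{h}. indicator {h} g * indicator X g)"
    unfolding char_functional.rep_eq delta.rep_eq by (rule infsum_cong_neutral) auto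
  then show ?thesis by simp
qed

lemma convolution_delta: "convolution (indicator {h}) b g = b (- h + g)"
proof -
  have "convolution (indicator {h}) b g = (\<Sum>\<^sub>\<infinity>k\<in>{h}. indicator {h} k * b (- k + g))"
    unfolding convolution_def by (rule infsum_cong_neutral) auto
  then show ?thesis by simp
qed

text \<open>Through this translation formula, values at point masses become measures of translates
  of \<open>X\<close>.\<close>

lemma char_functional_act_delta:
  "char_functional X \<circledast> delta h = char_functional {k. h + k \<in> X}"
proof (rule blinfun_eqI)
  fix b
  have "blinfun_apply (char_functional X \<circledast> delta h) b =
      (\<Sum>\<^sub>\<infinity>g. ell1_apply b (- h + g) * indicator X (h + (- h + g)))"
    by (simp add: dual_act.rep_eq char_functional.rep_eq times_ell1.rep_eq delta.rep_eq
        convolution_delta add.assoc[symmetric])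
  also have "\<dots> = (\<Sum>\<^sub>\<infinity>k. ell1_apply b k * indicator X (h + k))"
    by (rule infsum_shift[of "\<lambda>k. ell1_apply b k * indicator X (h + k)"])
  also have "\<dots> = blinfun_apply (char_functional {k. h + k \<in> X}) b"
    by (simp add: char_functional.rep_eq indicator_def)
  finally show "blinfun_apply (char_functional X \<circledast> delta h) b =
      blinfun_apply (char_functional {k. h + k \<in> X}) b" .
qed

lemma ell1_apply_sum: "ell1_apply (sum f F) g = (\<Sum>h\<in>F. ell1_apply (f h) g)"
  by (induction F rule: infinite_finite_induct) (simp_all add: zero_ell1.rep_eq plus_ell1.rep_eq)

text \<open>Finite combinations of point masses are dense in the summable functions; for them the
  bound is the triangle inequality, and continuity of \<open>\<xi>\<close> controls the
  remainder.\<close>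

lemma ell1_functional_le:
  fixes \<xi> :: "'g ell1 \<Rightarrow>\<^sub>L real"
  assumes c: "\<And>h. \<bar>blinfun_apply \<xi> (delta h)\<bar> \<le> c"
  shows "\<bar>blinfun_apply \<xi> a\<bar> \<le> c * norm a"
proof (rule field_le_epsilon)
  fix e :: real
  assume "e > 0"
  \<comment> \<open>With \<open>+ 1\<close> the quotient also makes sense for
    \<open>\<xi> = 0\<close>; the truncation error under \<open>\<xi>\<close> is then at most
    \<open>e\<close>.\<close>
  define d where "d = e / (norm \<xi> + 1)"
  have np: "norm \<xi> + 1 > 0" by (smt (verit) norm_ge_zero)
  have "d > 0" using \<open>e > 0\<close> np by (simp add: d_def)
  have sa: "(\<lambda>g. \<bar>ell1_apply a g\<bar>) summable_on UNIV"
    using ell1_apply[of a] by simp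
  then have "((\<lambda>g. \<bar>ell1_apply a g\<bar>) has_sum norm a) UNIV"
    unfolding norm_ell1.rep_eq by (rule has_sum_infsum)
  then obtain F where F: "finite F" "dist (\<Sum>g\<in>F. \<bar>ell1_apply a g\<bar>) (norm a) \<le> d"
    using has_sum_finite_approximation[OF _ \<open>d > 0\<close>] by blast
  define b where "b = (\<Sum>h\<in>F. ell1_apply a h *\<^sub>R delta h)"
  have b: "ell1_apply b g = (if g \<in> F then ell1_apply a g else 0)" for g
    using F(1) by (simp add: b_def ell1_apply_sum scaleR_ell1.rep_eq delta.rep_eq indicator_def
        if_distrib[of "\<lambda>x. _ * x"] sum.delta cong: if_cong)
  have "norm (a - b) = (\<Sum>\<^sub>\<infinity>g\<in>UNIV - F. \<bar>ell1_apply a g\<bar>)"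
    unfolding norm_ell1.rep_eq by (rule infsum_cong_neutral) (auto simp: minus_ell1.rep_eq b)
  also have "\<dots> = norm a - (\<Sum>g\<in>F. \<bar>ell1_apply a g\<bar>)"
    using F(1) sa by (subst infsum_Diff) (auto simp: norm_ell1.rep_eq)
  also have "\<dots> \<le> d"
    using F(2) by (simp add: dist_real_def)
  finally have ab: "norm (a - b) \<le> d" .
  have "\<bar>blinfun_apply \<xi> b\<bar> \<le> (\<Sum>h\<in>F. \<bar>ell1_apply a h\<bar> * \<bar>blinfun_apply \<xi> (delta h)\<bar>)"
    unfolding b_def by (simp add: blinfun.sum_right blinfun.scaleR_right abs_mult[symmetric] sum_abs)
  also have "\<dots> \<le> (\<Sum>h\<in>F. \<bar>ell1_apply a h\<bar> * c)"
    by (intro sum_mono mult_left_mono c) simp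
  also have "\<dots> = c * (\<Sum>h\<in>F. \<bar>ell1_apply a h\<bar>)"
    by (simp add: sum_distrib_left mult.commute)
  also have "\<dots> \<le> c * norm a"
  proof (rule mult_left_mono)
    show "(\<Sum>h\<in>F. \<bar>ell1_apply a h\<bar>) \<le> norm a"
      unfolding norm_ell1.rep_eq using F(1) sa by (intro finite_sum_le_infsum) auto
    show "0 \<le> c" using c[of undefined] by linarith
  qed
  finally have "\<bar>blinfun_apply \<xi> b\<bar> \<le> c * norm a" .
  moreover have "\<bar>blinfun_apply \<xi> (a - b)\<bar> \<le> e"
  proof -
    have "\<bar>blinfun_apply \<xi> (a - b)\<bar> \<le> norm \<xi> * norm (a - b)"
      using norm_blinfun[of \<xi> "a - b"] by simp
    also have "\<dots> \<le> (norm \<xi> + 1) * d"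
      using ab np \<open>d > 0\<close> by (intro mult_mono) auto
    also have "\<dots> = e" using np by (simp add: d_def)
    finally show ?thesis .
  qed
  ultimately show "\<bar>blinfun_apply \<xi> a\<bar> \<le> c * norm a + e"
    by (simp add: blinfun.diff_right)
qed

lemma ell1_functional_eqI:
  fixes \<xi> \<eta> :: "'g ell1 \<Rightarrow>\<^sub>L real"
  assumes "\<And>h. blinfun_apply \<xi> (delta h) = blinfun_apply \<eta> (delta h)"
  shows "\<xi> = \<eta>"
proof (rule blinfun_eqI)
  fix a
  show "blinfun_apply \<xi> a = blinfun_apply \<eta> a"
    using ell1_functional_le[of "\<xi> - \<eta>" 0 a] assms by (simp add: blinfun.diff_left)
qed

lemma bidual_act_delta:
  "blinfun_apply (\<omega> \<circledast>\<circledast> char_functional X) (delta h) = fa_measure \<omega> {k. h + k \<in> X}"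
  by (simp add: bidual_act.rep_eq char_functional_act_delta fa_measure_def)

lemma norm_char_functional_le: "norm (char_functional X) \<le> 1"
proof (rule norm_blinfun_bound)
  fix a
  show "norm (blinfun_apply (char_functional X) a) \<le> 1 * norm a"
    using ell1_functional_le[of "char_functional X" 1 a] by (simp add: indicator_def)
qed simp

lemma abs_fa_measure_le: "\<bar>fa_measure \<mu> A\<bar> \<le> norm \<mu>"
proof -
  have "\<bar>fa_measure \<mu> A\<bar> \<le> norm \<mu> * norm (char_functional A)"
    unfolding fa_measure_def using norm_blinfun[of \<mu> "char_functional A"] by simp
  also have "\<dots> \<le> norm \<mu> * 1"
    by (intro mult_left_mono norm_char_functional_le) simp
  finally show ?thesis by simp
qed


section \<open>Two-valued measures\<close>

text \<open>The Dirac measures transfer a covering of \<open>\<GG>\<close> to a covering of the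
  group, and show that \<open>\<GG>\<close> is nonempty.\<close>

lemma point_measure:
  fixes k :: 'g
  obtains \<omega> where "\<omega> \<in> \<GG>" "norm \<omega> \<le> 1" "\<And>A. fa_measure \<omega> A = indicator A k"
proof
  define \<omega> where "\<omega> = Blinfun (\<lambda>\<phi> :: 'g ell1 \<Rightarrow>\<^sub>L real. blinfun_apply \<phi> (delta k))"
  have *: "blinfun_apply \<omega> \<phi> = blinfun_apply \<phi> (delta k)" for \<phi>
    unfolding \<omega>_def
    by (rule bounded_linear_Blinfun_apply[THEN fun_cong]) (rule blinfun.bounded_linear_left)
  show m: "fa_measure \<omega> A = indicator A k" for A
    by (simp add: fa_measure_def *)
  show "\<omega> \<in> \<GG>"
    by (auto simp: two_valued_measures_def m indicator_def)
  show "norm \<omega> \<le> 1"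
  proof (rule norm_blinfun_bound)
    fix \<phi> :: "'g ell1 \<Rightarrow>\<^sub>L real"
    show "norm (blinfun_apply \<omega> \<phi>) \<le> 1 * norm \<phi>"
      using norm_blinfun[of \<phi> "delta k"] by (simp add: *)
  qed simp
qed

text \<open>Being two-valued is a closed condition on each value separately. Intersecting with the
  ball lets Banach-Alaoglu apply and keeps all Dirac measures.\<close>

lemma compactin_two_valued_measures:
  "compactin weak_star_topology (\<GG> \<inter> cball 0 1)"
proof (rule closed_compactin[OF Banach_Alaoglu])
  have "\<GG> = {\<omega>. \<forall>A\<in>UNIV. blinfun_apply \<omega> (char_functional A) \<in> (if A = UNIV then {1} else {0, 1})}"
    by (auto simp: two_valued_measures_def fa_measure_def)
  also have "closedin weak_star_topology \<dots>"
    by (rule closedin_weak_star_Ball) simp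
  finally show "closedin weak_star_topology (\<GG> \<inter> cball 0 1)"
    using closedin_weak_star_cball by blast
qed simp

text \<open>Each \<omega> lies in the cylinder around its own trace; compactness leaves finitely
  many cylinders, and testing them on Dirac measures gives the claim for points
  \<open>k\<close>.\<close>

lemma finite_cover_by_cylinders:
  fixes D :: "'i \<Rightarrow> 'g set" and Y :: "nat \<Rightarrow> 'i set"
  assumes Y: "\<And>\<omega>. \<omega> \<in> \<GG> \<Longrightarrow> \<exists>j. {h. fa_measure \<omega> (D h) = 1} = Y j"
    and F: "\<And>j. finite (F j)"
  shows "\<exists>N. \<forall>k. \<exists>j<N. \<forall>h\<in>F j. k \<in> D h \<longleftrightarrow> h \<in> Y j"
proof -
  \<comment> \<open>As the values on \<open>\<GG>\<close> are \<open>0\<close> or \<open>1\<close>,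
    open half-lines encode exact agreement with \<open>Y j\<close> on \<open>F j\<close>.\<close>
  define U where
    "U j = {\<omega>. \<forall>h\<in>F j. blinfun_apply \<omega> (char_functional (D h)) \<in> (if h \<in> Y j then {0 :: real<..} else {..<1})}"
    for j
  have op: "openin weak_star_topology (U j)" for j
    unfolding U_def by (rule strong_operator_topology_basis[OF F]) simp
  have U_iff: "\<omega> \<in> U j \<longleftrightarrow> (\<forall>h\<in>F j. fa_measure \<omega> (D h) = 1 \<longleftrightarrow> h \<in> Y j)" if "\<omega> \<in> \<GG>"
    for \<omega> :: "('g ell1 \<Rightarrow>\<^sub>L real) \<Rightarrow>\<^sub>L real" and j
  proof -
    have "fa_measure \<omega> (D h) \<in> {0, 1}" for h
      using that by (auto simp: two_valued_measures_def)
    then show ?thesis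
      unfolding U_def fa_measure_def[symmetric] mem_Collect_eq
      by (intro ball_cong refl) (smt (verit) greaterThan_iff lessThan_iff insert_iff empty_iff)
  qed
  have "\<GG> \<inter> cball 0 1 \<subseteq> \<Union> (range U)"
  proof
    fix \<omega> :: "('g ell1 \<Rightarrow>\<^sub>L real) \<Rightarrow>\<^sub>L real"
    assume \<omega>: "\<omega> \<in> \<GG> \<inter> cball 0 1"
    then obtain j where "{h. fa_measure \<omega> (D h) = 1} = Y j" using Y by blast
    then have "\<omega> \<in> U j" using U_iff[of \<omega> j] \<omega> by blast
    then show "\<omega> \<in> \<Union> (range U)" by blast
  qed
  then obtain \<F> where "finite \<F>" "\<F> \<subseteq> range U" "\<GG> \<inter> cball 0 1 \<subseteq> \<Union> \<F>"
    using compactinD[OF compactin_two_valued_measures, of "range U"] op by blast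
  then obtain J where J: "finite J" "\<GG> \<inter> cball 0 1 \<subseteq> \<Union> (U ` J)"
    by (metis finite_subset_image)
  obtain N where N: "\<And>j. j \<in> J \<Longrightarrow> j < N"
    using finite_nat_set_iff_bounded[THEN iffD1, OF J(1)] by blast
  show ?thesis
  proof (rule exI[of _ N], rule allI)
    fix k :: 'g
    obtain \<omega> where \<omega>: "\<omega> \<in> \<GG>" "norm \<omega> \<le> 1" "\<And>A. fa_measure \<omega> A = indicator A k"
      using point_measure[of k] by metis
    then have "\<omega> \<in> \<GG> \<inter> cball 0 1" by simp
    then obtain j where "j \<in> J" "\<omega> \<in> U j" using J(2) by blast
    then show "\<exists>j<N. \<forall>h\<in>F j. k \<in> D h \<longleftrightarrow> h \<in> Y j"
      using U_iff[OF \<omega>(1), of j] N[of j] by (auto simp: \<omega>(3) indicator_def intro!: exI[of _ j])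
  qed
qed

section \<open>The two implications of the equivalence\<close>

text \<open>Each scale \<open>1 / real (Suc n)\<close> contributes countably many traces, and a
  trace determines its functional, because the values at point masses are \<open>0\<close> or
  \<open>1\<close>.\<close>

lemma countable_if_right_asplund:
  fixes X :: "'g::group_add set"
  assumes cG: "countable (UNIV :: 'g set)" and ra: "right_asplund (char_functional X)"
  shows "countable {\<omega> \<circledast>\<circledast> char_functional X | \<omega>. \<omega> \<in> \<GG>}"
proof -
  define S where "S h = char_functional X \<circledast> delta h" for h
  \<comment> \<open>scaling moves \<open>\<omega>\<close> into the unit ball, so no bound on the norms of elements of \<open>\<GG>\<close> is needed\<close>
  define T where "T n = (\<lambda>\<psi>. {h. blinfun_apply \<psi> (S h) = 1 / real (Suc n)}) `
      {\<psi> \<in> cball 0 1. \<forall>h. blinfun_apply \<psi> (S h) \<in> {0, 1 / real (Suc n)}}" for n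
  have "countable (T n)" for n
    unfolding T_def
    by (rule countable_traces_if_fragmented_family[OF _ cG])
      (use ra in \<open>auto simp: right_asplund_def asplund_set_def S_def\<close>)
  then have "countable (\<Union>n. T n)" by blast
  moreover have "(\<lambda>\<xi>. {h. blinfun_apply \<xi> (delta h) = 1}) ` {\<omega> \<circledast>\<circledast> char_functional X | \<omega>. \<omega> \<in> \<GG>} \<subseteq> (\<Union>n. T n)"
  proof clarify
    fix \<omega> :: "('g ell1 \<Rightarrow>\<^sub>L real) \<Rightarrow>\<^sub>L real"
    assume \<omega>: "\<omega> \<in> \<GG>"
    obtain n where n: "norm \<omega> \<le> real n" using real_arch_simple by blast
    define \<psi> where "\<psi> = (1 / real (Suc n)) *\<^sub>R \<omega>"
    have *: "blinfun_apply \<psi> (S h) = fa_measure \<omega> {k. h + k \<in> X} / real (Suc n)" for h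
      by (simp add: \<psi>_def S_def char_functional_act_delta fa_measure_def blinfun.scaleR_left)
    have "norm \<psi> \<le> 1" using n by (simp add: \<psi>_def divide_simps)
    moreover have "blinfun_apply \<psi> (S h) \<in> {0, 1 / real (Suc n)}" for h
      using \<omega> unfolding * two_valued_measures_def by auto
    moreover have "{h. blinfun_apply (\<omega> \<circledast>\<circledast> char_functional X) (delta h) = 1} =
        {h. blinfun_apply \<psi> (S h) = 1 / real (Suc n)}"
      by (simp add: * bidual_act_delta divide_simps)
    ultimately show "{h. blinfun_apply (\<omega> \<circledast>\<circledast> char_functional X) (delta h) = 1} \<in> (\<Union>n. T n)"
      by (auto simp: T_def)
  qed
  ultimately have "countable ((\<lambda>\<xi>. {h. blinfun_apply \<xi> (delta h) = 1}) `
      {\<omega> \<circledast>\<circledast> char_functional X | \<omega>. \<omega> \<in> \<GG>})"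
    by (rule countable_subset[rotated])
  moreover have "inj_on (\<lambda>\<xi>. {h. blinfun_apply \<xi> (delta h) = 1}) {\<omega> \<circledast>\<circledast> char_functional X | \<omega>. \<omega> \<in> \<GG>}"
  proof (rule inj_onI, clarify)
    fix \<omega> \<omega>' :: "('g ell1 \<Rightarrow>\<^sub>L real) \<Rightarrow>\<^sub>L real"
    assume "\<omega> \<in> \<GG>" "\<omega>' \<in> \<GG>" and
      eq: "{h. blinfun_apply (\<omega> \<circledast>\<circledast> char_functional X) (delta h) = 1} =
        {h. blinfun_apply (\<omega>' \<circledast>\<circledast> char_functional X) (delta h) = 1}"
    then have "fa_measure \<omega> A \<in> {0, 1}" "fa_measure \<omega>' A \<in> {0, 1}" for A
      by (auto simp: two_valued_measures_def)
    then have "fa_measure \<omega> A = fa_measure \<omega>' A \<longleftrightarrow> (fa_measure \<omega> A = 1 \<longleftrightarrow> fa_measure \<omega>' A = 1)" for A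
      by (metis insert_iff singletonD)
    with eq show "\<omega> \<circledast>\<circledast> char_functional X = \<omega>' \<circledast>\<circledast> char_functional X"
      by (intro ell1_functional_eqI) (simp add: bidual_act_delta set_eq_iff)
  qed
  ultimately show ?thesis
    by (rule countable_image_inj_on)
qed

text \<open>Rational combinations of the enumerated functionals form a countable set that
  approximates the image of every \<psi> in the unit ball, as
  \<open>fragmented_familyI_countable\<close> demands.\<close>

lemma right_asplund_if_countable:
  fixes X :: "'g::group_add set"
  assumes cE: "countable {\<omega> \<circledast>\<circledast> char_functional X | \<omega>. \<omega> \<in> \<GG>}"
  shows "right_asplund (char_functional X)"
proof -
  define E where "E = {\<omega> \<circledast>\<circledast> char_functional X | \<omega>. \<omega> \<in> \<GG>}"
  define D where "D h = {k. h + k \<in> X}" for h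
  obtain \<omega>0 :: "('g ell1 \<Rightarrow>\<^sub>L real) \<Rightarrow>\<^sub>L real" where "\<omega>0 \<in> \<GG>"
    by (rule point_measure)
  then have "E \<noteq> {}" by (auto simp: E_def)
  define y where "y = from_nat_into E"
  have range_y: "range y = E"
    using cE \<open>E \<noteq> {}\<close> by (simp add: y_def E_def range_from_nat_into)
  define Y where "Y j = {h. blinfun_apply (y j) (delta h) = 1}" for j
  have y_delta: "blinfun_apply (y j) (delta h) = indicator (Y j) h" for j h
  proof -
    have "y j \<in> E" using range_y by blast
    then obtain \<omega> where "\<omega> \<in> \<GG>" "y j = \<omega> \<circledast>\<circledast> char_functional X" by (auto simp: E_def)
    then have "blinfun_apply (y j) (delta h) \<in> {0, 1}"
      by (auto simp: bidual_act_delta two_valued_measures_def)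
    then show ?thesis by (auto simp: Y_def indicator_def)
  qed
  have trace: "\<exists>j. {h. fa_measure \<omega> (D h) = 1} = Y j" if "\<omega> \<in> \<GG>" for \<omega>
  proof -
    have "\<omega> \<circledast>\<circledast> char_functional X \<in> range y"
      using that range_y by (auto simp: E_def)
    then obtain j where "\<omega> \<circledast>\<circledast> char_functional X = y j" by blast
    then show ?thesis
      by (intro exI[of _ j]) (simp add: Y_def D_def flip: bidual_act_delta)
  qed
  \<comment> \<open>Finite lists of rationals form a countable type, hence \<open>range z\<close> is
    countable.\<close>
  define z where "z qs = blinfun_apply (\<Sum>j<length qs. real_of_rat (qs ! j) *\<^sub>R y j)" for qs
  have z_delta: "z qs (delta h) = (\<Sum>j<length qs. real_of_rat (qs ! j) * indicator (Y j) h)" for qs h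
    by (simp add: z_def blinfun.sum_left blinfun.scaleR_left y_delta)
  have "fragmented_family ((\<lambda>a. char_functional X \<circledast> a) ` cball 0 1)"
  proof (rule fragmented_familyI_countable[where Z = "range z"])
    fix \<psi> :: "('g ell1 \<Rightarrow>\<^sub>L real) \<Rightarrow>\<^sub>L real" and e :: real
    assume "norm \<psi> \<le> 1" "e > 0"
    have "\<exists>N c. \<forall>h. \<bar>fa_measure \<psi> (D h) - (\<Sum>j<N. c j * indicator (Y j) h)\<bar> \<le> e / 2"
      by (rule finitely_additive_approx[where M = "norm \<psi>"])
        (use finite_cover_by_cylinders[OF trace] \<open>e > 0\<close> in
          \<open>auto simp: fa_measure_additive abs_fa_measure_le\<close>)
    then obtain N c where
      c: "\<And>h. \<bar>fa_measure \<psi> (D h) - (\<Sum>j<N. c j * indicator (Y j) h)\<bar> \<le> e / 2" by blast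
    \<comment> \<open>Rounding \<open>N\<close> coefficients costs at most \<open>e / 2\<close> in
      total; \<open>+ 1\<close> covers \<open>N = 0\<close>.\<close>
    have "\<exists>q. \<bar>c j - real_of_rat q\<bar> \<le> e / (2 * (real N + 1))" for j
    proof -
      have "c j < c j + e / (2 * (real N + 1))" using \<open>e > 0\<close> by simp
      then obtain q where "c j < real_of_rat q" "real_of_rat q < c j + e / (2 * (real N + 1))"
        using of_rat_dense by blast
      then show ?thesis by (intro exI[of _ q]) simp
    qed
    then obtain q where q: "\<And>j. \<bar>c j - real_of_rat (q j)\<bar> \<le> e / (2 * (real N + 1))"
      by metis
    define qs where "qs = map q [0..<N]"
    \<comment> \<open>The error is itself a functional, so its bound at point masses extends to the
      whole ball.\<close>
    define \<xi> where "\<xi> = \<psi> \<circledast>\<circledast> char_functional X - (\<Sum>j<length qs. real_of_rat (qs ! j) *\<^sub>R y j)"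
    have \<xi>: "blinfun_apply \<xi> a = blinfun_apply \<psi> (char_functional X \<circledast> a) - z qs a" for a
      by (simp add: \<xi>_def z_def blinfun.diff_left bidual_act.rep_eq)
    have "\<bar>blinfun_apply \<xi> (delta h)\<bar> \<le> e" for h
    proof -
      have "(\<Sum>j<N. c j * indicator (Y j) h) - z qs (delta h) =
          (\<Sum>j<N. (c j - real_of_rat (q j)) * indicator (Y j) h)"
        by (simp add: z_delta qs_def left_diff_distrib sum_subtractf)
      also have "\<bar>\<dots>\<bar> \<le> (\<Sum>j<N. e / (2 * (real N + 1)))"
      proof (rule order_trans[OF sum_abs sum_mono])
        fix j
        show "\<bar>(c j - real_of_rat (q j)) * indicator (Y j) h\<bar> \<le> e / (2 * (real N + 1))"
          using q[of j] \<open>e > 0\<close> by (auto simp: indicator_def)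
      qed
      also have "\<dots> \<le> e / 2" using \<open>e > 0\<close> by (simp add: divide_simps)
      finally have "\<bar>(\<Sum>j<N. c j * indicator (Y j) h) - z qs (delta h)\<bar> \<le> e / 2" .
      moreover have "blinfun_apply \<psi> (char_functional X \<circledast> delta h) = fa_measure \<psi> (D h)"
        by (simp add: char_functional_act_delta fa_measure_def D_def)
      ultimately show ?thesis using c[of h] unfolding \<xi> by linarith
    qed
    then have "\<bar>blinfun_apply \<xi> a\<bar> \<le> e * norm a" for a
      by (rule ell1_functional_le)
    then have "\<bar>blinfun_apply \<xi> a\<bar> \<le> e" if "norm a \<le> 1" for a
      using that mult_left_mono[of "norm a" 1 e] \<open>e > 0\<close> by (intro order_trans[OF \<open>\<bar>blinfun_apply \<xi> a\<bar> \<le> e * norm a\<close>]) simp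
    then show "\<exists>w\<in>range z. \<forall>a\<in>cball 0 1. \<bar>blinfun_apply \<psi> (char_functional X \<circledast> a) - w a\<bar> \<le> e"
      by (auto simp: \<xi> intro!: exI[of _ qs])
  qed simp
  moreover have "bounded ((\<lambda>a. char_functional X \<circledast> a) ` cball 0 1)"
  proof (rule boundedI)
    fix x assume "x \<in> (\<lambda>a. char_functional X \<circledast> a) ` cball 0 1"
    then obtain a where a: "norm a \<le> 1" "x = char_functional X \<circledast> a" by auto
    then show "norm x \<le> norm (char_functional X)"
      using norm_dual_act_le[of "char_functional X" a] mult_left_mono[OF a(1), of "norm (char_functional X)"]
      by simp
  qed
  ultimately show ?thesis
    by (simp add: right_asplund_def asplund_set_def)
qed

theorem proposition6p10:
  fixes X :: "'g::group_add set"
  assumes "countable (UNIV :: 'g set)"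
  shows "right_asplund (char_functional X) \<longleftrightarrow>
    countable {\<omega> \<circledast>\<circledast> char_functional X | \<omega>. \<omega> \<in> \<GG>}"
  using countable_if_right_asplund[OF assms] right_asplund_if_countable by blast

end
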